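(* Let $q\ge 0$ and $m\ge1$ be integers, $\Gamma=\{-q,\dots,0,\dots,q\}$ and $N=2q+1$. Let $A\in\mathbb{C}^{m\times N}$ have entries $$A_{l,k}=e^{2\pi \mathrm{i}kt_l},\qquad t_l=\frac{l-1}{m}+\delta_l,\quad l=1,\dots,m,\quad k\in\Gamma,$$ where $\delta_l\in(0,T)$ and $0<T<\frac1m$ (so that $t_1<\dots<t_m$ and $\operatorname{rank}(A)=\min\{m,N\}$). Write $N=am+b$ with $a=\lfloor N/m\rfloor$, $0\le b<m$. Let $\beta_{\max}=\pi\sqrt m\,N^{3/2}T$, $y=Ax+e$ and $\hat{x}=A^\dagger y$. (i) Case $m\ge N$. Let $\alpha=\sqrt m$ and $\eta=2\alpha\beta_{\max}+\beta_{\max}^2$, and assume $T<\min\left\{\frac1m,\frac{1}{(\sqrt2+1)\pi N^{3/2}}\right\}$. Then $$\frac{N}{m(m+\eta)}\,\epsilon^2\le\mathbb{E}\big[\|\hat{x}-x\|^2\big]\le\frac{N}{m(m-\eta)}\,\epsilon^2.$$ (ii) Case $m<N$. Let $\alpha=\sqrt{m\lceil N/m\rceil}$ and $\eta=2\alpha\beta_{\max}+\beta_{\max}^2$, and assume $T<\min\left\{\frac1m,\frac{\sqrt{2N}-\sqrt{N+m}}{\pi\sqrt m\,N^{3/2}}\right\}$. Then $$\frac{N+m+\eta-2b}{(ma+\eta)[m(a+1)+\eta]}\,\epsilon^2+N-m\le\mathbb{E}\big[\|\hat{x}-x\|^2\big]\le\frac{N+m-\eta-2b}{(ma-\eta)[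m(a+1)-\eta]}\,\epsilon^2+N-m.$$
   Context: The perturbations $\delta_l$ are arbitrary deterministic numbers in $(0,T)$. Observation model: $y=Ax+e$, where $x\in\mathbb{C}^N$ is a random vector with $\mathbb{E}[xx^*]=I_N$, and $e\in\mathbb{C}^m$ is noise with $\operatorname{Re}(e),\operatorname{Im}(e)\sim\mathcal{N}(0,\frac{\epsilon^2}{2m}I_m)$ independent of each other (so $\mathbb{E}[ee^*]=\frac{\epsilon^2}{m}I_m$), with $\epsilon>0$. The vectors $x$ and $e$ are independent. $A^\dagger$ denotes the Moore–Penrose inverse and $\|\cdot\|$ the Euclidean norm. The expectation is over $x$ and $e$. *)

theory Defs
  imports
    "HOL-Probability.Probability"
    "Jordan_Normal_Form.Schur_Decomposition"
begin

unbundle no vec_syntax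

section \<open>Euclidean norm and Moore--Penrose inverse\<close>

definition cvec_norm :: "complex vec \<Rightarrow> real" where
  "cvec_norm v = L2_set (\<lambda>i. cmod (v $ i)) {..<dim_vec v}"

definition is_moore_penrose_inverse :: "complex mat \<Rightarrow> complex mat \<Rightarrow> bool" where
  "is_moore_penrose_inverse A X \<longleftrightarrow>
     X \<in> carrier_mat (dim_col A) (dim_row A) \<and>
     A * X * A = A \<and> X * A * X = X \<and>
     mat_adjoint (A * X) = A * X \<and> mat_adjoint (X * A) = X * A"

definition moore_penrose_inverse :: "complex mat \<Rightarrow> complex mat" where
  "moore_penrose_inverse A = (THE X. is_moore_penrose_inverse A X)"

lemma mat_adjoint_carrier:
  fixes A :: "complex mat"
  assumes "A \<in> carrier_mat n k"
  shows "mat_adjoint A \<in> carrier_mat k n"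
  using assms unfolding mat_adjoint_def by auto

lemma mat_adjoint_index:
  fixes A :: "complex mat"
  assumes "A \<in> carrier_mat n k" "i < k" "j < n"
  shows "mat_adjoint A $$ (i, j) = cnj (A $$ (j, i))"
  using assms unfolding mat_adjoint_def by (auto simp: mat_of_rows_def)

lemma mat_adjoint_times:
  fixes A B :: "complex mat"
  assumes A: "A \<in> carrier_mat n k" and B: "B \<in> carrier_mat k p"
  shows "mat_adjoint (A * B) = mat_adjoint B * mat_adjoint A"
proof (rule eq_matI)
  have AB: "A * B \<in> carrier_mat n p" using A B by simp
  note adj = mat_adjoint_carrier[OF A] mat_adjoint_carrier[OF B] mat_adjoint_carrier[OF AB]
  show "dim_row (mat_adjoint (A * B)) = dim_row (mat_adjoint B * mat_adjoint A)"
    and "dim_col (mat_adjoint (A * B)) = dim_col (mat_adjoint B * mat_adjoint A)"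
    using adj by auto
  fix i j assume "i < dim_row (mat_adjoint B * mat_adjoint A)"
    and "j < dim_col (mat_adjoint B * mat_adjoint A)"
  then have i: "i < p" and j: "j < n" using adj by auto
  show "mat_adjoint (A * B) $$ (i, j) = (mat_adjoint B * mat_adjoint A) $$ (i, j)"
    using A B adj i j
    by (simp add: mat_adjoint_index[OF AB] scalar_prod_def mat_adjoint_index[OF A]
        mat_adjoint_index[OF B] mult.commute)
qed

lemma is_moore_penrose_inverse_unique:
  assumes "is_moore_penrose_inverse A X" "is_moore_penrose_inverse A Y"
  shows "X = Y"
proof -
  obtain n k where A: "A \<in> carrier_mat n k" by blast
  have X: "X \<in> carrier_mat k n" and Y: "Y \<in> carrier_mat k n"
    using assms A by (auto simp: is_moore_penrose_inverse_def)
  note x = assms(1)[unfolded is_moore_penrose_inverse_def]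
  note y = assms(2)[unfolded is_moore_penrose_inverse_def]
  have AX: "A * X \<in> carrier_mat n n" and AY: "A * Y \<in> carrier_mat n n"
    and XA: "X * A \<in> carrier_mat k k" and YA: "Y * A \<in> carrier_mat k k"
    using A X Y by auto
  have "A * X = (A * Y * A) * X" using y by simp
  also have "\<dots> = (A * Y) * (A * X)" by (rule assoc_mult_mat[OF AY A X])
  also have "\<dots> = mat_adjoint (A * Y) * mat_adjoint (A * X)" using x y by simp
  also have "\<dots> = mat_adjoint ((A * X) * (A * Y))"
    using mat_adjoint_times[OF AX AY] by simp
  also have "(A * X) * (A * Y) = (A * X * A) * Y"
    using assoc_mult_mat[OF AX A Y] by simp
  also have "mat_adjoint \<dots> = A * Y" using x y by simp
  finally have eq1: "A * X = A * Y" .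
  have "X * A = X * (A * Y * A)" using y by simp
  also have "\<dots> = (X * A) * (Y * A)"
    using assoc_mult_mat[OF X AY A] assoc_mult_mat[OF X A Y] assoc_mult_mat[OF XA Y A] by simp
  also have "\<dots> = mat_adjoint (X * A) * mat_adjoint (Y * A)" using x y by simp
  also have "\<dots> = mat_adjoint ((Y * A) * (X * A))"
    using mat_adjoint_times[OF YA XA] by simp
  also have "(Y * A) * (X * A) = Y * (A * X * A)"
    using assoc_mult_mat[OF Y AX A] assoc_mult_mat[OF Y A X] assoc_mult_mat[OF YA X A] by simp
  also have "mat_adjoint \<dots> = Y * A" using x y by simp
  finally have eq2: "X * A = Y * A" .
  have "X = Y * A * X" using x eq2 by simp
  also have "\<dots> = Y * (A * X)" by (rule assoc_mult_mat[OF Y A X])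
  also have "\<dots> = Y * A * Y" using assoc_mult_mat[OF Y A Y] eq1 by simp
  finally show ?thesis using y by simp
qed

lemma moore_penrose_inverse_eqI:
  "is_moore_penrose_inverse A X \<Longrightarrow> moore_penrose_inverse A = X"
  unfolding moore_penrose_inverse_def
  by (blast intro: the_equality is_moore_penrose_inverse_unique)

section \<open>Random vectors\<close>

text \<open>
  The Borel sigma-algebra on the vectors of dimension \<open>n\<close>, transported from the finite
  product of copies of \<^const>\<open>borel\<close> along the coordinate bijection.
\<close>

definition vec_borel :: "nat \<Rightarrow> 'a :: topological_space vec measure" where
  "vec_borel n =
     vimage_algebra (carrier_vec n) (\<lambda>v. \<lambda>i\<in>{..<n}. v $ i) (Pi\<^sub>M {..<n} (\<lambda>_. borel))"

text \<open>
  The Gaussian law with mean \<open>0\<close> and covariance matrix \<open>\<sigma>\<^sup>2 I\<^sub>n\<close>; as in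
  \<^const>\<open>normal_density\<close>, the parameter \<open>\<sigma>\<close> is the standard deviation.
\<close>

definition gaussian_vec :: "nat \<Rightarrow> real \<Rightarrow> real vec measure" where
  "gaussian_vec n \<sigma> =
     distr (Pi\<^sub>M {..<n} (\<lambda>_. density lborel (\<lambda>u. ennreal (normal_density 0 \<sigma> u))))
       (vec_borel n) (\<lambda>f. vec n f)"

lemma space_vec_borel [simp]: "space (vec_borel n) = carrier_vec n"
  by (simp add: vec_borel_def)

lemma measurable_vec_index:
  assumes "i < n"
  shows "(\<lambda>v. v $ i) \<in> borel_measurable (vec_borel n)"
proof -
  have "(\<lambda>v. (\<lambda>i\<in>{..<n}. v $ i) i) \<in> borel_measurable (vec_borel n)"
    unfolding vec_borel_def
    by (rule measurable_compose[OF measurable_vimage_algebra1 measurable_component_singleton])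
       (use assms in \<open>auto simp: space_PiM PiE_def extensional_def\<close>)
  then show ?thesis using assms by simp
qed

lemma measurable_vec_borelI:
  assumes "\<And>\<omega>. \<omega> \<in> space M \<Longrightarrow> f \<omega> \<in> carrier_vec n"
    and "\<And>i. i < n \<Longrightarrow> (\<lambda>\<omega>. f \<omega> $ i) \<in> borel_measurable M"
  shows "f \<in> measurable M (vec_borel n)"
  unfolding vec_borel_def
  by (rule measurable_vimage_algebra2) (use assms in \<open>auto intro!: measurable_restrict\<close>)

section \<open>Nonuniform Fourier matrix\<close>

text \<open>
  The matrix indices start at \<open>0\<close>: row \<open>i\<close> belongs to the sample point \<open>t (i + 1)\<close>, and
  column \<open>j\<close> belongs to the frequency \<open>j - q\<close> in \<open>{-q..q}\<close>.
\<close>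

definition fourier_mat :: "nat \<Rightarrow> nat \<Rightarrow> (nat \<Rightarrow> real) \<Rightarrow> complex mat" where
  "fourier_mat m q t =
     mat m (2 * q + 1)
       (\<lambda>(i, j). exp (2 * complex_of_real pi * \<i> * of_int (int j - int q) * of_real (t (i + 1))))"

end

theory Submission
  imports Defs
begin

text \<open>
  With \<open>X\<close> the Moore--Penrose inverse of \<open>A\<close>, the error is \<open>(X A - 1) x + X e\<close>, and the second
  moments of \<open>x\<close> and \<open>e\<close> turn its mean square into
  \<open>\<parallel>X A - 1\<parallel>\<^sup>2 + (\<epsilon>\<^sup>2 / m) \<parallel>X\<parallel>\<^sup>2\<close> in Frobenius norms. The first summand is \<open>0\<close> or
  \<open>N - m\<close>, because \<open>1 - X A\<close> is a projection, and the second is the trace of the inverse of a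
  Gram matrix \<open>G = C C\<^sup>*\<close>, where \<open>C = A\<^sup>*\<close> if \<open>m \<ge> N\<close> and \<open>C = U\<^sup>* A\<close> with a discrete Fourier
  matrix \<open>U\<close> if \<open>m < N\<close>.

  In these coordinates the Gram matrix of the equispaced samples is diagonal, with entries \<open>d r\<close>
  equal to \<open>m\<close>, respectively to \<open>m\<close> times the number of frequencies in the \<open>r\<close>-th residue class.
  The jitter moves \<open>A\<close> by at most \<open>\<beta>\<close> in Frobenius norm. No eigenvalue perturbation theory is
  needed: for \<open>h = G\<inverse> e\<^sub>r\<close> the diagonal entry
  \<open>\<tau> = h\<^sub>r = \<parallel>C\<^sup>* h\<parallel>\<^sup>2\<close> of the inverse satisfies \<open>(d r - \<eta>) \<tau>\<^sup>2 \<le> \<tau>\<close>, and Cauchy--Schwarz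
  applied to \<open>1 = \<langle>C\<^sup>* e\<^sub>r, C\<^sup>* h\<rangle>\<close> gives \<open>1 \<le> (d r + \<eta>) \<tau>\<close>.
\<close>

section \<open>Euclidean and Frobenius norms\<close>

lemma cvec_norm_nonneg [simp]: "0 \<le> cvec_norm v"
  by (simp add: cvec_norm_def)

lemma cvec_norm_sq: "(cvec_norm v)\<^sup>2 = (\<Sum>i<dim_vec v. (cmod (v $ i))\<^sup>2)"
  by (simp add: cvec_norm_def L2_set_def sum_nonneg)

lemma cscalar_prod_self: "v \<bullet>c v = complex_of_real ((cvec_norm v)\<^sup>2)"
  unfolding cvec_norm_sq scalar_prod_def
  by (auto simp: complex_norm_square lessThan_atLeast0 simp del: of_real_power intro!: sum.cong)

lemma cvec_norm_add_le:
  assumes "u \<in> carrier_vec n" "v \<in> carrier_vec n"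
  shows "cvec_norm (u + v) \<le> cvec_norm u + cvec_norm v"
proof -
  have "cvec_norm (u + v) \<le> L2_set (\<lambda>i. cmod (u $ i) + cmod (v $ i)) {..<n}"
    using assms unfolding cvec_norm_def by (auto intro!: L2_set_mono norm_triangle_ineq)
  also have "\<dots> \<le> cvec_norm u + cvec_norm v"
    using assms unfolding cvec_norm_def by (auto intro: L2_set_triangle_ineq)
  finally show ?thesis .
qed

lemma cscalar_prod_Cauchy_Schwarz:
  assumes "u \<in> carrier_vec n" "v \<in> carrier_vec n"
  shows "cmod (u \<bullet>c v) \<le> cvec_norm u * cvec_norm v"
proof -
  have "cmod (u \<bullet>c v) \<le> (\<Sum>i<n. \<bar>cmod (u $ i)\<bar> * \<bar>cmod (v $ i)\<bar>)"
    using assms unfolding scalar_prod_def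
    by (auto simp: lessThan_atLeast0 norm_mult intro!: sum_norm_le)
  also have "\<dots> \<le> cvec_norm u * cvec_norm v"
    using assms L2_set_mult_ineq[of "\<lambda>i. cmod (u $ i)" "\<lambda>i. cmod (v $ i)" "{..<n}"]
    by (simp add: cvec_norm_def)
  finally show ?thesis .
qed

lemma mat_adjoint_adjoint:
  fixes A :: "complex mat"
  assumes "A \<in> carrier_mat n k"
  shows "mat_adjoint (mat_adjoint A) = A"
  using assms mat_adjoint_carrier[OF assms] mat_adjoint_carrier[OF mat_adjoint_carrier[OF assms]]
  by (intro eq_matI) (auto simp: mat_adjoint_index[of _ k n] mat_adjoint_index[of _ n k])

lemma mat_adjoint_one: "mat_adjoint (1\<^sub>m n :: complex mat) = 1\<^sub>m n"
  using mat_adjoint_carrier[of "1\<^sub>m n :: complex mat" n n]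
  by (intro eq_matI) (auto simp: mat_adjoint_index[of _ n n])

lemma cscalar_prod_mult_mat_vec:
  fixes A :: "complex mat"
  assumes A: "A \<in> carrier_mat n k" and v: "v \<in> carrier_vec k" and u: "u \<in> carrier_vec n"
  shows "(A *\<^sub>v v) \<bullet>c u = v \<bullet>c (mat_adjoint A *\<^sub>v u)"
proof -
  note A' = mat_adjoint_carrier[OF A]
  have "(A *\<^sub>v v) \<bullet>c u = (\<Sum>i<n. \<Sum>j<k. A $$ (i, j) * v $ j * cnj (u $ i))"
    using A v u by (simp add: scalar_prod_def lessThan_atLeast0 sum_distrib_right)
  also have "\<dots> = (\<Sum>j<k. \<Sum>i<n. A $$ (i, j) * v $ j * cnj (u $ i))"
    by (rule sum.swap)
  also have "\<dots> = v \<bullet>c (mat_adjoint A *\<^sub>v u)"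
    using A' v u by (simp add: scalar_prod_def lessThan_atLeast0 sum_distrib_left
        mat_adjoint_index[OF A] ac_simps)
  finally show ?thesis .
qed

definition frobenius_sq :: "complex mat \<Rightarrow> real" where
  "frobenius_sq A = (\<Sum>i<dim_row A. \<Sum>j<dim_col A. (cmod (A $$ (i, j)))\<^sup>2)"

definition mat_trace :: "'a :: semiring_0 mat \<Rightarrow> 'a" where
  "mat_trace A = (\<Sum>i<dim_row A. A $$ (i, i))"

lemma mat_trace_mult_commute:
  fixes A B :: "'a :: comm_semiring_0 mat"
  assumes "A \<in> carrier_mat n k" "B \<in> carrier_mat k n"
  shows "mat_trace (A * B) = mat_trace (B * A)"
proof -
  have "mat_trace (A * B) = (\<Sum>i<n. \<Sum>j<k. A $$ (i, j) * B $$ (j, i))"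
    using assms by (simp add: mat_trace_def scalar_prod_def lessThan_atLeast0)
  also have "\<dots> = (\<Sum>j<k. \<Sum>i<n. B $$ (j, i) * A $$ (i, j))"
    by (subst sum.swap) (simp add: mult.commute)
  also have "\<dots> = mat_trace (B * A)"
    using assms by (simp add: mat_trace_def scalar_prod_def lessThan_atLeast0)
  finally show ?thesis .
qed

text \<open>Turns Frobenius norms into traces, so that cyclicity can rearrange the factors of a
  pseudoinverse.\<close>

lemma frobenius_sq_eq_trace:
  assumes A: "A \<in> carrier_mat n k"
  shows "frobenius_sq A = Re (mat_trace (A * mat_adjoint A))"
proof -
  note A' = mat_adjoint_carrier[OF A]
  have "A $$ (i, j) * mat_adjoint A $$ (j, i) = complex_of_real ((cmod (A $$ (i, j)))\<^sup>2)"
    if "i < n" "j < k" for i j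
    using that by (simp add: mat_adjoint_index[OF A] complex_norm_square del: of_real_power)
  then have "mat_trace (A * mat_adjoint A) = complex_of_real (frobenius_sq A)"
    using A A' by (simp add: mat_trace_def frobenius_sq_def scalar_prod_def lessThan_atLeast0
        del: of_real_power)
  then show ?thesis by simp
qed

lemma frobenius_sq_adjoint:
  assumes A: "A \<in> carrier_mat n k"
  shows "frobenius_sq (mat_adjoint A) = frobenius_sq A"
  unfolding frobenius_sq_eq_trace[OF A] frobenius_sq_eq_trace[OF mat_adjoint_carrier[OF A]]
    mat_adjoint_adjoint[OF A] mat_trace_mult_commute[OF A mat_adjoint_carrier[OF A]] ..

text \<open>Cauchy--Schwarz on each row, summed over the rows: the Frobenius norm dominates the
  operator norm.\<close>

lemma cvec_norm_mult_mat_vec_le: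
  assumes A: "A \<in> carrier_mat n k" and v: "v \<in> carrier_vec k"
    and c: "frobenius_sq A \<le> c\<^sup>2" "0 \<le> c"
  shows "cvec_norm (A *\<^sub>v v) \<le> c * cvec_norm v"
proof -
  have "(cmod ((A *\<^sub>v v) $ i))\<^sup>2 \<le> (\<Sum>j<k. (cmod (A $$ (i, j)))\<^sup>2) * (cvec_norm v)\<^sup>2" if i: "i < n" for i
  proof -
    \<comment> \<open>Conjugating \<open>v\<close> beforehand cancels the conjugation built into
      \<open>\<bullet>c\<close>.\<close>
    have "(A *\<^sub>v v) $ i = row A i \<bullet>c conjugate v" using A v i by simp
    then have "cmod ((A *\<^sub>v v) $ i) \<le> cvec_norm (row A i) * cvec_norm (conjugate v)"
      using A v by (metis cscalar_prod_Cauchy_Schwarz carrier_vec_conjugate row_carrier carrier_matD(2))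
    also have "cvec_norm (conjugate v) = cvec_norm v"
      by (auto simp: cvec_norm_def intro!: L2_set_cong)
    finally have "(cmod ((A *\<^sub>v v) $ i))\<^sup>2 \<le> (cvec_norm (row A i))\<^sup>2 * (cvec_norm v)\<^sup>2"
      by (metis power_mono norm_ge_zero power_mult_distrib)
    also have "(cvec_norm (row A i))\<^sup>2 = (\<Sum>j<k. (cmod (A $$ (i, j)))\<^sup>2)"
      unfolding cvec_norm_sq using A i by simp
    finally show ?thesis .
  qed
  then have "(cvec_norm (A *\<^sub>v v))\<^sup>2 \<le> (\<Sum>i<n. (\<Sum>j<k. (cmod (A $$ (i, j)))\<^sup>2) * (cvec_norm v)\<^sup>2)"
    unfolding cvec_norm_sq[of "A *\<^sub>v v"] using A by (auto intro!: sum_mono)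
  also have "\<dots> = frobenius_sq A * (cvec_norm v)\<^sup>2"
    using A by (simp add: frobenius_sq_def sum_distrib_right)
  also have "\<dots> \<le> (c * cvec_norm v)\<^sup>2"
    using c by (simp add: power_mult_distrib mult_right_mono)
  finally show ?thesis by (rule power2_le_imp_le) (use c in simp)
qed

section \<open>Perturbation of a diagonal Gram matrix\<close>

text \<open>When the squared norm of \<open>mat_adjoint C *\<^sub>v w\<close> is expanded around
  \<open>C0\<close>, the cross term costs at most 2 \<alpha> \<beta> and the last term \<beta>^2,
  both times |w|^2; this is \<eta>. As a quadratic form the Gram matrix thus lies between the
  diagonals d - \<eta> and d + \<eta>. The lower form gives invertibility and is tested on columns
  of the inverse, the upper one on unit vectors.\<close>

lemma gram_inverse:
  fixes C C0 :: "complex mat" and d :: "nat \<Rightarrow> real"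
  assumes C: "C \<in> carrier_mat n p" and C0: "C0 \<in> carrier_mat n p"
    and gram: "C0 * mat_adjoint C0 = mat_diag n (\<lambda>r. complex_of_real (d r))"
    and close: "\<And>w. w \<in> carrier_vec n \<Longrightarrow> cvec_norm (mat_adjoint (C - C0) *\<^sub>v w) \<le> \<beta> * cvec_norm w"
    and \<alpha>: "0 \<le> \<alpha>" "\<And>r. r < n \<Longrightarrow> d r \<le> \<alpha>\<^sup>2"
    and \<beta>: "0 \<le> \<beta>"
    and \<eta>: "\<eta> = 2 * \<alpha> * \<beta> + \<beta>\<^sup>2" "\<And>r. r < n \<Longrightarrow> \<eta> < d r"
  obtains H where "H \<in> carrier_mat n n"
    "(C * mat_adjoint C) * H = 1\<^sub>m n" "H * (C * mat_adjoint C) = 1\<^sub>m n" "mat_adjoint H = H"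
    "(\<Sum>r<n. 1 / (d r + \<eta>)) \<le> Re (mat_trace H)" "Re (mat_trace H) \<le> (\<Sum>r<n. 1 / (d r - \<eta>))"
proof -
  define G where "G = C * mat_adjoint C"
  note C' = mat_adjoint_carrier[OF C] and C0' = mat_adjoint_carrier[OF C0]
  have CC: "C - C0 \<in> carrier_mat n p" using C C0 by (simp add: minus_carrier_mat)
  note CC' = mat_adjoint_carrier[OF CC]
  have G: "G \<in> carrier_mat n n" using C C' by (simp add: G_def)
  have \<eta>0: "0 \<le> \<eta>" using \<alpha> \<beta> \<eta> by simp
  have norm_C0: "(cvec_norm (mat_adjoint C0 *\<^sub>v w))\<^sup>2 = (\<Sum>r<n. d r * (cmod (w $ r))\<^sup>2)"
    if w: "w \<in> carrier_vec n" for w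
  proof -
    have "complex_of_real ((cvec_norm (mat_adjoint C0 *\<^sub>v w))\<^sup>2)
        = (mat_adjoint C0 *\<^sub>v w) \<bullet>c (mat_adjoint C0 *\<^sub>v w)"
      by (rule cscalar_prod_self[symmetric])
    also have "\<dots> = (C0 *\<^sub>v (mat_adjoint C0 *\<^sub>v w)) \<bullet>c w"
      using cscalar_prod_mult_mat_vec[OF C0 _ w] C0' w by (simp add: mult_mat_vec_carrier)
    also have "C0 *\<^sub>v (mat_adjoint C0 *\<^sub>v w) = mat_diag n (\<lambda>r. complex_of_real (d r)) *\<^sub>v w"
      using assoc_mult_mat_vec[OF C0 C0' w] gram by simp
    also have "\<dots> = vec n (\<lambda>r. d r * w $ r)"
      using w by (intro eq_vecI) (auto simp: mat_diag_def scalar_prod_def mult_delta_left)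
    also have "\<dots> \<bullet>c w = (\<Sum>r<n. complex_of_real (d r * (cmod (w $ r))\<^sup>2))"
      using w by (auto simp: scalar_prod_def lessThan_atLeast0 complex_norm_square mult.assoc
          simp del: of_real_power)
    finally show ?thesis by (simp only: of_real_sum[symmetric] of_real_eq_iff)
  qed
  have diff: "mat_adjoint C *\<^sub>v w = mat_adjoint C0 *\<^sub>v w + mat_adjoint (C - C0) *\<^sub>v w"
    if w: "w \<in> carrier_vec n" for w
  proof -
    have "mat_adjoint C = mat_adjoint C0 + mat_adjoint (C - C0)"
      using C C0 C' C0' CC CC'
      by (intro eq_matI) (auto simp: mat_adjoint_index[of _ n p])
    then show ?thesis using add_mult_distrib_mat_vec[OF C0' CC' w] by simp
  qed
  have norm_le: "cvec_norm (mat_adjoint C0 *\<^sub>v w) \<le> \<alpha> * cvec_norm w" if w: "w \<in> carrier_vec n" for w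
  proof (rule power2_le_imp_le)
    have "(\<Sum>r<n. d r * (cmod (w $ r))\<^sup>2) \<le> (\<Sum>r<n. \<alpha>\<^sup>2 * (cmod (w $ r))\<^sup>2)"
      using \<alpha> by (intro sum_mono mult_right_mono) auto
    then show "(cvec_norm (mat_adjoint C0 *\<^sub>v w))\<^sup>2 \<le> (\<alpha> * cvec_norm w)\<^sup>2"
      using w by (simp add: norm_C0 power_mult_distrib cvec_norm_sq[of w] sum_distrib_left)
  qed (use \<alpha> in auto)
  have upper: "(cvec_norm (mat_adjoint C *\<^sub>v w))\<^sup>2 \<le> (\<Sum>r<n. d r * (cmod (w $ r))\<^sup>2) + \<eta> * (cvec_norm w)\<^sup>2"
    if w: "w \<in> carrier_vec n" for w
  proof -
    let ?X = "cvec_norm (mat_adjoint C0 *\<^sub>v w)" and ?Y = "cvec_norm (mat_adjoint (C - C0) *\<^sub>v w)"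
    have XY: "?X * ?Y \<le> (\<alpha> * cvec_norm w) * (\<beta> * cvec_norm w)" and Y: "?Y\<^sup>2 \<le> (\<beta> * cvec_norm w)\<^sup>2"
      using norm_le[OF w] close[OF w] \<alpha> \<beta> by (auto intro!: mult_mono power_mono)
    have "cvec_norm (mat_adjoint C *\<^sub>v w) \<le> ?X + ?Y"
      unfolding diff[OF w] using C0' CC' w by (intro cvec_norm_add_le[where n = p]) auto
    then have "(cvec_norm (mat_adjoint C *\<^sub>v w))\<^sup>2 \<le> (?X + ?Y)\<^sup>2"
      by (intro power_mono) auto
    also have "\<dots> \<le> ?X\<^sup>2 + \<eta> * (cvec_norm w)\<^sup>2"
      using XY Y by (simp add: power2_eq_square algebra_simps \<eta>(1))
    finally show ?thesis using norm_C0[OF w] by simp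
  qed
  have lower: "(\<Sum>r<n. (d r - \<eta>) * (cmod (w $ r))\<^sup>2) \<le> (cvec_norm (mat_adjoint C *\<^sub>v w))\<^sup>2"
    if w: "w \<in> carrier_vec n" for w
  proof -
    let ?X = "cvec_norm (mat_adjoint C0 *\<^sub>v w)" and ?Y = "cvec_norm (mat_adjoint (C - C0) *\<^sub>v w)"
      and ?Z = "cvec_norm (mat_adjoint C *\<^sub>v w)"
    have XY: "?X * ?Y \<le> (\<alpha> * cvec_norm w) * (\<beta> * cvec_norm w)"
      using norm_le[OF w] close[OF w] \<alpha> \<beta> by (auto intro!: mult_mono)
    have "mat_adjoint C0 *\<^sub>v w = mat_adjoint C *\<^sub>v w + (- (mat_adjoint (C - C0) *\<^sub>v w))"
      unfolding diff[OF w] using C0' CC' w by (intro eq_vecI) auto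
    then have "?X \<le> ?Z + cvec_norm (- (mat_adjoint (C - C0) *\<^sub>v w))"
      using cvec_norm_add_le[of "mat_adjoint C *\<^sub>v w" p "- (mat_adjoint (C - C0) *\<^sub>v w)"] C' CC' w
      by simp
    also have "cvec_norm (- (mat_adjoint (C - C0) *\<^sub>v w)) = ?Y"
      using CC' w by (auto simp: cvec_norm_def intro!: L2_set_cong)
    finally have "?X \<le> ?Z + ?Y" .
    \<comment> \<open>Squaring X - Y \<le> Z is legitimate only if Y \<le> X. Otherwise the left
      side is at most - X Y, hence not positive.\<close>
    have "?X\<^sup>2 - 2 * (?X * ?Y) \<le> ?Z\<^sup>2"
    proof (cases "?Y \<le> ?X")
      case True
      then have "(?X - ?Y)\<^sup>2 \<le> ?Z\<^sup>2" using \<open>?X \<le> ?Z + ?Y\<close> by (intro power_mono) auto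
      moreover have "(?X - ?Y)\<^sup>2 = ?X\<^sup>2 - 2 * (?X * ?Y) + ?Y\<^sup>2" by (simp add: power2_eq_square algebra_simps)
      ultimately show ?thesis by (smt (verit) zero_le_power2)
    next
      case False
      then have "?X * ?X \<le> ?X * ?Y" by (intro mult_left_mono) auto
      then show ?thesis by (smt (verit) zero_le_power2 power2_eq_square cvec_norm_nonneg mult_nonneg_nonneg)
    qed
    moreover have "2 * ((\<alpha> * cvec_norm w) * (\<beta> * cvec_norm w)) \<le> \<eta> * (cvec_norm w)\<^sup>2"
      using \<beta> by (simp add: \<eta>(1) power2_eq_square algebra_simps)
    ultimately have "?X\<^sup>2 - \<eta> * (cvec_norm w)\<^sup>2 \<le> ?Z\<^sup>2" using XY by linarith
    then show ?thesis using w
      by (simp add: norm_C0 cvec_norm_sq[of w] sum_distrib_left left_diff_distrib sum_subtractf)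
  qed
  have gram_C: "v \<bullet>c (G *\<^sub>v w) = (mat_adjoint C *\<^sub>v v) \<bullet>c (mat_adjoint C *\<^sub>v w)"
    if "v \<in> carrier_vec n" "w \<in> carrier_vec n" for v w
    using that cscalar_prod_mult_mat_vec[OF C' that(1), of "mat_adjoint C *\<^sub>v w"] C' C
    by (simp add: G_def mat_adjoint_adjoint[OF C] assoc_mult_mat_vec[OF C C'])
  have nn: "0 \<le> (d r - \<eta>) * (cmod (w $ r))\<^sup>2" if "r < n" for r w
    using \<eta>(2)[OF that] by simp
  \<comment> \<open>For a kernel vector \<open>v\<close> the right side of \<open>lower\<close> is
    zero; since its weights are positive, all entries of \<open>v\<close> vanish.\<close>
  have "det G \<noteq> 0"
  proof
    assume "det G = 0"
    then obtain v where v: "v \<in> carrier_vec n" "v \<noteq> 0\<^sub>v n" "G *\<^sub>v v = 0\<^sub>v n"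
      using det_0_iff_vec_prod_zero[OF G] by auto
    have "complex_of_real ((cvec_norm (mat_adjoint C *\<^sub>v v))\<^sup>2) = 0"
      using gram_C[OF v(1) v(1)] v(1) v(3) unfolding cscalar_prod_self[symmetric] by simp
    then have "(\<Sum>r<n. (d r - \<eta>) * (cmod (v $ r))\<^sup>2) \<le> 0"
      using lower[OF v(1)] by simp
    then have "(\<Sum>r<n. (d r - \<eta>) * (cmod (v $ r))\<^sup>2) = 0"
      by (rule antisym) (auto intro!: sum_nonneg nn)
    then have "(d r - \<eta>) * (cmod (v $ r))\<^sup>2 = 0" if "r < n" for r
      using nn that by (subst (asm) sum_nonneg_eq_0_iff) blast+
    then have "v $ r = 0" if "r < n" for r using \<eta>(2) that by force
    then have "v = 0\<^sub>v n" using v(1) by (intro eq_vecI) auto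
    with v(2) show False by simp
  qed
  \<comment> \<open>A unit of the matrix ring has a two-sided inverse by definition;
    \<open>()\<close> only fills the extension slot of the ring record.\<close>
  from det_non_zero_imp_unit[OF G this, of "()"]
  obtain H where H: "H \<in> carrier_mat n n" and HG: "H * G = 1\<^sub>m n" and GH: "G * H = 1\<^sub>m n"
    unfolding Units_def ring_mat_def by auto
  \<comment> \<open>The adjoint of \<open>H\<close> is again a left inverse of the self-adjoint
    \<open>G\<close>, so it must be \<open>H\<close>.\<close>
  have "mat_adjoint G = G"
    unfolding G_def mat_adjoint_times[OF C C'] mat_adjoint_adjoint[OF C] ..
  then have "mat_adjoint H * G = mat_adjoint (1\<^sub>m n)"
    using mat_adjoint_times[OF G H] GH by simp
  also note mat_adjoint_one
  finally have "mat_adjoint H * G * H = H" using H by simp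
  then have herm: "mat_adjoint H = H"
    using assoc_mult_mat[OF mat_adjoint_carrier[OF H] G H] GH mat_adjoint_carrier[OF H] by simp
  have entry: "1 / (d r + \<eta>) \<le> Re (H $$ (r, r)) \<and> Re (H $$ (r, r)) \<le> 1 / (d r - \<eta>)" if r: "r < n" for r
  proof -
    define h where "h = col H r"
    have h: "h \<in> carrier_vec n" using H r by (auto simp: h_def)
    have er: "unit_vec n r \<in> carrier_vec n" by simp
    have "G *\<^sub>v h = col (G * H) r" unfolding h_def using G H r by (intro eq_vecI) auto
    then have Gh: "G *\<^sub>v h = unit_vec n r" using r GH by simp
    \<comment> \<open>This number is the quadratic form of \<open>G\<close> at \<open>h\<close> and
      at the same time the entry \<open>h $ r\<close>, which is therefore real and
      non-negative.\<close>
    define \<tau> where "\<tau> = (cvec_norm (mat_adjoint C *\<^sub>v h))\<^sup>2"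
    have conj_unit: "conjugate (unit_vec n r) = (unit_vec n r :: complex vec)"
      using r by (intro eq_vecI) (auto simp: unit_vec_def)
    have "h $ r = h \<bullet>c unit_vec n r" unfolding conj_unit using h r by simp
    also have "\<dots> = complex_of_real \<tau>"
      unfolding Gh[symmetric] gram_C[OF h h] cscalar_prod_self \<tau>_def ..
    finally have hr: "h $ r = complex_of_real \<tau>" .
    then have Hr: "H $$ (r, r) = complex_of_real \<tau>" using H r by (simp add: h_def)
    have \<tau>0: "0 \<le> \<tau>" by (simp add: \<tau>_def)
    \<comment> \<open>The other weights are non-negative; dropping them leaves a quadratic
      inequality in \<tau> alone.\<close>
    have "(d r - \<eta>) * (cmod (h $ r))\<^sup>2 \<le> (\<Sum>s<n. (d s - \<eta>) * (cmod (h $ s))\<^sup>2)"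
      using r nn by (intro member_le_sum) auto
    also have "\<dots> \<le> \<tau>" unfolding \<tau>_def by (rule lower[OF h])
    finally have "(d r - \<eta>) * \<tau> * \<tau> \<le> 1 * \<tau>" using \<tau>0 by (simp add: hr power2_eq_square)
    then have "\<tau> = 0 \<or> (d r - \<eta>) * \<tau> \<le> 1"
      using \<tau>0 mult_le_cancel_right[of "(d r - \<eta>) * \<tau>" \<tau> 1] by linarith
    then have "\<tau> \<le> 1 / (d r - \<eta>)"
      using \<eta>(2)[OF r] by (auto simp: pos_le_divide_eq mult.commute)
    moreover have "1 / (d r + \<eta>) \<le> \<tau>"
    proof -
      let ?e = "unit_vec n r :: complex vec"
      have "1 = cmod (?e \<bullet>c ?e)" using r conj_unit by simp
      also have "?e \<bullet>c ?e = (mat_adjoint C *\<^sub>v ?e) \<bullet>c (mat_adjoint C *\<^sub>v h)"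
        using gram_C[OF er h] Gh by simp
      also have "cmod \<dots> \<le> cvec_norm (mat_adjoint C *\<^sub>v ?e) * cvec_norm (mat_adjoint C *\<^sub>v h)"
        using C' h by (intro cscalar_prod_Cauchy_Schwarz[where n = p]) auto
      finally have "1\<^sup>2 \<le> (cvec_norm (mat_adjoint C *\<^sub>v ?e) * cvec_norm (mat_adjoint C *\<^sub>v h))\<^sup>2"
        by (intro power_mono) auto
      then have "1 \<le> (cvec_norm (mat_adjoint C *\<^sub>v ?e))\<^sup>2 * \<tau>" by (simp add: \<tau>_def power_mult_distrib)
      moreover have "(cvec_norm (mat_adjoint C *\<^sub>v ?e))\<^sup>2 \<le> d r + \<eta>"
      proof -
        have e_sq: "(cmod (?e $ i))\<^sup>2 = (if i = r then 1 else 0)" if "i < n" for i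
          using that r by simp
        have "(\<Sum>i<n. d i * (cmod (?e $ i))\<^sup>2) = (\<Sum>i<n. if i = r then d i else 0)"
          using e_sq by (intro sum.cong) auto
        moreover have "(cvec_norm ?e)\<^sup>2 = (\<Sum>i<n. if i = r then 1 else 0)"
          unfolding cvec_norm_sq using e_sq by (intro sum.cong) auto
        ultimately show ?thesis using upper[OF er] r by simp
      qed
      ultimately have "1 \<le> (d r + \<eta>) * \<tau>" using \<tau>0 mult_right_mono order_trans by blast
      then show ?thesis using \<eta>(2)[OF r] \<eta>0 by (simp add: pos_divide_le_eq mult.commute)
    qed
    ultimately show ?thesis by (simp add: Hr)
  qed
  have "Re (mat_trace H) = (\<Sum>r<n. Re (H $$ (r, r)))" using H by (simp add: mat_trace_def)
  then have "(\<Sum>r<n. 1 / (d r + \<eta>)) \<le> Re (mat_trace H)" "Re (mat_trace H) \<le> (\<Sum>r<n. 1 / (d r - \<eta>))"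
    using entry by (auto intro!: sum_mono)
  from that[OF H GH[unfolded G_def] HG[unfolded G_def] herm this] show thesis .
qed

section \<open>Moore--Penrose inverses of full-rank matrices\<close>

text \<open>The solution operator X = H A' of the normal equations, with ' for the adjoint. It
  satisfies X A = 1 and X' = A H, so A X is self-adjoint and X X' = H.\<close>

lemma full_column_rank_moore_penrose_inverse:
  assumes A: "A \<in> carrier_mat m n" and H: "H \<in> carrier_mat n n"
    and inv: "(mat_adjoint A * A) * H = 1\<^sub>m n" "H * (mat_adjoint A * A) = 1\<^sub>m n"
    and herm: "mat_adjoint H = H"
  shows "is_moore_penrose_inverse A (H * mat_adjoint A)"
    and "H * mat_adjoint A * A = 1\<^sub>m n"
    and "frobenius_sq (H * mat_adjoint A) = Re (mat_trace H)"
proof -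
  define X where "X = H * mat_adjoint A"
  note A' = mat_adjoint_carrier[OF A]
  have X: "X \<in> carrier_mat n m" using H A' by (simp add: X_def)
  have XA: "X * A = 1\<^sub>m n" unfolding X_def using assoc_mult_mat[OF H A' A] inv by simp
  have adj_X: "mat_adjoint X = A * H"
    unfolding X_def mat_adjoint_times[OF H A'] herm mat_adjoint_adjoint[OF A] ..
  have "mat_adjoint (A * X) = A * X"
    unfolding mat_adjoint_times[OF A X] adj_X unfolding X_def by (rule assoc_mult_mat[OF A H A'])
  moreover have "A * X * A = A" using assoc_mult_mat[OF A X A] XA A by simp
  ultimately show "is_moore_penrose_inverse A (H * mat_adjoint A)"
    unfolding X_def[symmetric] is_moore_penrose_inverse_def using X A by (simp add: XA mat_adjoint_one)
  show "H * mat_adjoint A * A = 1\<^sub>m n" using XA by (simp add: X_def)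
  have "X * mat_adjoint X = H"
    using assoc_mult_mat[OF X A H] XA H by (simp add: adj_X)
  then show "frobenius_sq (H * mat_adjoint A) = Re (mat_trace H)"
    unfolding X_def[symmetric] using frobenius_sq_eq_trace[OF X] by simp
qed

text \<open>For A = U C with unitary \<open>U\<close> and ' for the adjoint, A A' has the inverse U
  H U', so X = A' U H U' = C' H U'. The matrix X' X = U H U' has the trace of \<open>H\<close>, so
  the trace can be computed in the rotated coordinates.\<close>

lemma full_row_rank_moore_penrose_inverse:
  assumes C: "C \<in> carrier_mat m n" and H: "H \<in> carrier_mat m m" and U: "U \<in> carrier_mat m m"
    and inv: "(C * mat_adjoint C) * H = 1\<^sub>m m" and herm: "mat_adjoint H = H"
    and unitary: "U * mat_adjoint U = 1\<^sub>m m" "mat_adjoint U * U = 1\<^sub>m m"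
  defines "X \<equiv> mat_adjoint C * H * mat_adjoint U"
  shows "is_moore_penrose_inverse (U * C) X"
    and "U * C * X = 1\<^sub>m m"
    and "frobenius_sq X = Re (mat_trace H)"
proof -
  note C' = mat_adjoint_carrier[OF C] and U' = mat_adjoint_carrier[OF U]
  have C'H: "mat_adjoint C * H \<in> carrier_mat n m" using C' H by simp
  have UC: "U * C \<in> carrier_mat m n" using U C by simp
  have X: "X \<in> carrier_mat n m" using C'H U' by (simp add: X_def)
  have CX: "C * X = mat_adjoint U"
  proof -
    have "C * X = C * (mat_adjoint C * H) * mat_adjoint U"
      unfolding X_def by (rule assoc_mult_mat[OF C C'H U', symmetric])
    also have "C * (mat_adjoint C * H) = 1\<^sub>m m"
      using assoc_mult_mat[OF C C' H] inv by simp
    finally show ?thesis using U' by simp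
  qed
  show AX: "U * C * X = 1\<^sub>m m"
    unfolding assoc_mult_mat[OF U C X] CX by (rule unitary)
  have adj_C'H: "mat_adjoint (mat_adjoint C * H) = H * C"
    unfolding mat_adjoint_times[OF C' H] herm mat_adjoint_adjoint[OF C] ..
  have HC: "H * C \<in> carrier_mat m n" using H C by simp
  have adj_X: "mat_adjoint X = U * (H * C)"
    unfolding X_def mat_adjoint_times[OF C'H U'] adj_C'H mat_adjoint_adjoint[OF U] ..
  have XA: "X * (U * C) = mat_adjoint C * (H * C)"
  proof -
    have "X * (U * C) = mat_adjoint C * H * (mat_adjoint U * (U * C))"
      unfolding X_def by (rule assoc_mult_mat[OF C'H U' UC])
    also have "mat_adjoint U * (U * C) = C"
      using assoc_mult_mat[OF U' U C] unitary C by simp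
    finally show ?thesis using assoc_mult_mat[OF C' H C] by simp
  qed
  have "mat_adjoint (X * (U * C)) = X * (U * C)"
    unfolding XA mat_adjoint_times[OF C' HC] mat_adjoint_times[OF H C] herm mat_adjoint_adjoint[OF C]
    by (rule assoc_mult_mat[OF C' H C])
  moreover have "X * (U * C) * X = X" using assoc_mult_mat[OF X UC X] AX X by simp
  ultimately show "is_moore_penrose_inverse (U * C) X"
    unfolding is_moore_penrose_inverse_def using X U C AX left_mult_one_mat[OF UC] by (simp add: mat_adjoint_one)
  have "mat_adjoint X * X = U * (H * mat_adjoint U)"
    unfolding adj_X using assoc_mult_mat[OF U HC X] assoc_mult_mat[OF H C X] CX by simp
  then have "mat_trace (mat_adjoint X * X) = mat_trace (H * mat_adjoint U * U)"
    using mat_trace_mult_commute[OF U, of "H * mat_adjoint U"] H U' by simp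
  also have "H * mat_adjoint U * U = H" using assoc_mult_mat[OF H U' U] unitary H by simp
  finally show "frobenius_sq X = Re (mat_trace H)"
    using frobenius_sq_eq_trace[OF mat_adjoint_carrier[OF X]] frobenius_sq_adjoint[OF X]
      mat_adjoint_adjoint[OF X] by simp
qed

text \<open>1 - X A is the orthogonal projection onto the kernel of A. Its squared Frobenius norm is
  its trace, and cyclicity replaces the trace of X A by that of A X = 1.\<close>

lemma frobenius_sq_minus_projection:
  assumes A: "A \<in> carrier_mat m n" and X: "X \<in> carrier_mat n m"
    and AX: "A * X = 1\<^sub>m m" and herm: "mat_adjoint (X * A) = X * A"
  shows "frobenius_sq (X * A - 1\<^sub>m n) = real n - real m"
proof -
  define P where "P = X * A - 1\<^sub>m n"
  have XA: "X * A \<in> carrier_mat n n" using X A by simp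
  have P: "P \<in> carrier_mat n n" by (simp add: P_def minus_carrier_mat)
  have "mat_adjoint P = P"
  proof (rule eq_matI)
    fix i j assume "i < dim_row P" "j < dim_col P"
    then have ij: "i < n" "j < n" using P by auto
    have "cnj ((X * A) $$ (j, i)) = (X * A) $$ (i, j)"
      using mat_adjoint_index[OF XA ij] herm by simp
    then show "mat_adjoint P $$ (i, j) = P $$ (i, j)"
      unfolding mat_adjoint_index[OF P ij] using ij A X by (simp add: P_def del: index_mult_mat)
  qed (use P mat_adjoint_carrier[OF P] in auto)
  moreover have "A * P = 0\<^sub>m m n"
    unfolding P_def mult_minus_distrib_mat[OF A XA one_carrier_mat]
    using assoc_mult_mat[OF A X A] AX A by simp
  then have "X * A * P = 0\<^sub>m n n" using assoc_mult_mat[OF X A P] X by simp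
  moreover have "P * P = X * A * P - 1\<^sub>m n * P"
    by (subst (1) P_def) (rule minus_mult_distrib_mat[OF XA one_carrier_mat P])
  \<comment> \<open>\<open>P\<close> is minus a projection, so its product with its adjoint is P^2 =
    - P.\<close>
  ultimately have "P * mat_adjoint P = 0\<^sub>m n n - P" using P by simp
  then have "mat_trace (P * mat_adjoint P) = (\<Sum>i<n. 1 - (X * A) $$ (i, i))"
    using P X A by (simp add: mat_trace_def P_def del: index_mult_mat(1))
  also have "\<dots> = of_nat n - mat_trace (X * A)"
    using X by (simp add: mat_trace_def sum_subtractf)
  also have "mat_trace (X * A) = of_nat m"
    unfolding mat_trace_mult_commute[OF X A] AX by (simp add: mat_trace_def)
  finally show ?thesis using frobenius_sq_eq_trace[OF P] by (simp add: P_def)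
qed

section \<open>Second moments\<close>

text \<open>Under a product measure the integral of a product of one-variable functions factorises.
  Free exponents cover means and covariances at once.\<close>

lemma gaussian_vec_monomial:
  assumes \<sigma>: "0 < \<sigma>"
  shows "has_bochner_integral (gaussian_vec n \<sigma>) (\<lambda>v. \<Prod>k<n. (v $ k) ^ p k)
    (\<Prod>k<n. \<integral>u. normal_density 0 \<sigma> u * u ^ p k \<partial>lborel)"
proof -
  define D where "D = density lborel (\<lambda>u. ennreal (normal_density 0 \<sigma> u))"
  have D: "prob_space D" unfolding D_def by (rule prob_space_normal_density[OF \<sigma>])
  interpret product_sigma_finite "\<lambda>_::nat. D"
    using D by (simp add: product_sigma_finite_def prob_space_imp_sigma_finite)
  have sets_D [measurable_cong]: "sets D = sets borel" by (simp add: D_def)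
  have int: "integrable D (\<lambda>u. u ^ p k)" for k
    using integrable_normal_moment[OF \<sigma>, of 0 "p k"] by (simp add: D_def integrable_density)
  have eq: "integral\<^sup>L D (\<lambda>u. u ^ p k) = (\<integral>u. normal_density 0 \<sigma> u * u ^ p k \<partial>lborel)" for k
    by (simp add: D_def integral_density)
  have vec: "(\<lambda>f. vec n f) \<in> measurable (Pi\<^sub>M {..<n} (\<lambda>_. D)) (vec_borel n)"
    by (rule measurable_vec_borelI) auto
  have mono: "(\<lambda>v :: real vec. \<Prod>k<n. (v $ k) ^ p k) \<in> borel_measurable (vec_borel n)"
    by (intro borel_measurable_prod borel_measurable_power measurable_vec_index) auto
  have "integrable (Pi\<^sub>M {..<n} (\<lambda>_. D)) (\<lambda>f. \<Prod>k<n. f k ^ p k)"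
    using product_integrable_prod[of "{..<n}" "\<lambda>k u. u ^ p k"] int by simp
  moreover have "integral\<^sup>L (Pi\<^sub>M {..<n} (\<lambda>_. D)) (\<lambda>f. \<Prod>k<n. f k ^ p k)
      = (\<Prod>k<n. \<integral>u. normal_density 0 \<sigma> u * u ^ p k \<partial>lborel)"
    using product_integral_prod[of "{..<n}" "\<lambda>k u. u ^ p k"] int by (simp add: eq)
  ultimately show ?thesis
    unfolding gaussian_vec_def D_def[symmetric] has_bochner_integral_iff
    by (simp add: integrable_distr_eq[OF vec mono] integral_distr[OF vec mono])
qed

lemma gaussian_vec_mean:
  assumes \<sigma>: "0 < \<sigma>" and i: "i < n"
  shows "has_bochner_integral (gaussian_vec n \<sigma>) (\<lambda>v. v $ i) 0"
proof -
  \<comment> \<open>The factor at \<open>i\<close> is the first moment of a centred normal law,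
    which makes the whole product zero.\<close>
  let ?p = "\<lambda>k. if k = i then 1 else 0 :: nat"
  have "(\<Prod>k<n. (v $ k) ^ ?p k) = v $ i" for v :: "real vec"
    using i by (simp add: if_distrib[of "\<lambda>e. _ ^ e"] cong: if_cong)
  moreover have "(\<Prod>k<n. \<integral>u. normal_density 0 \<sigma> u * u ^ ?p k \<partial>lborel) = 0"
    using i integral_normal_moment_nz_1[OF \<sigma>, of 0] by (intro prod_zero) (auto intro!: bexI[of _ i])
  ultimately show ?thesis using gaussian_vec_monomial[OF \<sigma>, of n ?p] by (simp only:)
qed

lemma gaussian_vec_covariance:
  assumes \<sigma>: "0 < \<sigma>" and i: "i < n" and j: "j < n"
  shows "has_bochner_integral (gaussian_vec n \<sigma>) (\<lambda>v. v $ i * v $ j) (if i = j then \<sigma>\<^sup>2 else 0)"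
proof -
  let ?e = "\<lambda>i k. if k = i then 1 else 0 :: nat"
  \<comment> \<open>The exponents add up to 2 at \<open>i\<close> if i = j; otherwise the factor at
    \<open>i\<close> is a first moment and vanishes.\<close>
  let ?p = "\<lambda>k. ?e i k + ?e j k"
  have 1: "(\<Prod>k<n. (v $ k) ^ ?e i k) = v $ i" if "i < n" for v :: "real vec" and i
    using that by (simp add: if_distrib[of "\<lambda>e. _ ^ e"] cong: if_cong)
  have "(\<Prod>k<n. (v $ k) ^ ?p k) = v $ i * v $ j" for v :: "real vec"
    unfolding power_add prod.distrib 1[OF i] 1[OF j] ..
  moreover have "(\<Prod>k<n. \<integral>u. normal_density 0 \<sigma> u * u ^ ?p k \<partial>lborel) = (if i = j then \<sigma>\<^sup>2 else 0)"
  proof (cases "i = j")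
    case True
    have "(\<integral>u. normal_density 0 \<sigma> u * u\<^sup>2 \<partial>lborel) = \<sigma>\<^sup>2"
      using integral_normal_moment_even[OF \<sigma>, of 0 1] by (simp add: fact_numeral)
    then have "(\<integral>u. normal_density 0 \<sigma> u * u ^ ?p k \<partial>lborel) = (if k = i then \<sigma>\<^sup>2 else 1)" for k
      using True integral_normal_density[OF \<sigma>, of 0] by (simp add: numeral_2_eq_2)
    then show ?thesis using True i by simp
  next
    case False
    then show ?thesis using i integral_normal_moment_nz_1[OF \<sigma>, of 0]
      by (auto intro!: prod_zero bexI[of _ i])
  qed
  ultimately show ?thesis using gaussian_vec_monomial[OF \<sigma>, of n ?p] by (simp only:)
qed

text \<open>In the product of one entry with the conjugate of another, the two products of like
  parts each contribute \<sigma>^2 on the diagonal, hence the factor 2. The products of a real with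
  an imaginary part have mean zero by independence.\<close>

lemma (in prob_space) white_noise_covariance:
  fixes e :: "'a \<Rightarrow> complex vec"
  assumes \<sigma>: "0 < \<sigma>" and e: "e \<in> measurable M (vec_borel m)"
    and Re_e: "distr M (vec_borel m) (\<lambda>\<omega>. map_vec Re (e \<omega>)) = gaussian_vec m \<sigma>"
    and Im_e: "distr M (vec_borel m) (\<lambda>\<omega>. map_vec Im (e \<omega>)) = gaussian_vec m \<sigma>"
    and indep: "indep_var (vec_borel m) (\<lambda>\<omega>. map_vec Re (e \<omega>)) (vec_borel m) (\<lambda>\<omega>. map_vec Im (e \<omega>))"
    and i: "i < m" and j: "j < m"
  shows "has_bochner_integral M (\<lambda>\<omega>. e \<omega> $ i) 0"
    and "has_bochner_integral M (\<lambda>\<omega>. e \<omega> $ i * cnj (e \<omega> $ j)) (if i = j then of_real (2 * \<sigma>\<^sup>2) else 0)"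
proof -
  have dim: "dim_vec (e \<omega>) = m" if "\<omega> \<in> space M" for \<omega>
    using measurable_space[OF e that] by simp
  have meas: "(\<lambda>\<omega>. e \<omega> $ k) \<in> borel_measurable M" if "k < m" for k
    by (rule measurable_compose[OF e measurable_vec_index[OF that]])
  have part_meas: "(\<lambda>\<omega>. map_vec part (e \<omega>)) \<in> measurable M (vec_borel m)"
    if part: "part \<in> borel_measurable borel" for part :: "complex \<Rightarrow> real"
  proof (rule measurable_vec_borelI)
    fix k assume k: "k < m"
    have "(\<lambda>\<omega>. part (e \<omega> $ k)) \<in> borel_measurable M"
      by (rule measurable_compose[OF meas[OF k] part])
    \<comment> \<open>Indexing a mapped vector requires its dimension, which is known only for
      \<omega> in the space of \<open>M\<close>; hence the congruence over that space.\<close>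
    then show "(\<lambda>\<omega>. map_vec part (e \<omega>) $ k) \<in> borel_measurable M"
      by (rule measurable_cong[THEN iffD1, rotated]) (use dim k in auto)
  qed (auto intro!: carrier_vecI simp: dim)
  \<comment> \<open>\<open>part\<close> stands for \<open>Re\<close> or \<open>Im\<close>; the
    Gaussian moments are carried over to \<open>M\<close> along the law of that part.\<close>
  have moments: "has_bochner_integral M (\<lambda>\<omega>. part (e \<omega> $ k)) 0"
    "has_bochner_integral M (\<lambda>\<omega>. part (e \<omega> $ k) * part (e \<omega> $ l)) (if k = l then \<sigma>\<^sup>2 else 0)"
    if law: "distr M (vec_borel m) (\<lambda>\<omega>. map_vec part (e \<omega>)) = gaussian_vec m \<sigma>"
      and part: "part \<in> borel_measurable borel" and k: "k < m" and l: "l < m"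
    for part :: "complex \<Rightarrow> real" and k l
  proof -
    note pm = part_meas[OF part]
    have eq: "has_bochner_integral M (\<lambda>\<omega>. g (map_vec part (e \<omega>))) c"
      if "has_bochner_integral (gaussian_vec m \<sigma>) g c" and "g \<in> borel_measurable (vec_borel m)"
      for g :: "real vec \<Rightarrow> real" and c
      using that unfolding law[symmetric] has_bochner_integral_iff
      by (simp add: integrable_distr_eq[OF pm] integral_distr[OF pm])
    have "has_bochner_integral M (\<lambda>\<omega>. map_vec part (e \<omega>) $ k) 0"
      by (rule eq[OF gaussian_vec_mean[OF \<sigma> k] measurable_vec_index[OF k]])
    then show "has_bochner_integral M (\<lambda>\<omega>. part (e \<omega> $ k)) 0"
      by (rule has_bochner_integral_cong[THEN iffD1, rotated -1]) (use dim k in auto)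
    have "has_bochner_integral M (\<lambda>\<omega>. map_vec part (e \<omega>) $ k * map_vec part (e \<omega>) $ l)
        (if k = l then \<sigma>\<^sup>2 else 0)"
      by (rule eq[OF gaussian_vec_covariance[OF \<sigma> k l]
            borel_measurable_times[OF measurable_vec_index[OF k] measurable_vec_index[OF l]]])
    then show "has_bochner_integral M (\<lambda>\<omega>. part (e \<omega> $ k) * part (e \<omega> $ l)) (if k = l then \<sigma>\<^sup>2 else 0)"
      by (rule has_bochner_integral_cong[THEN iffD1, rotated -1]) (use dim k l in auto)
  qed
  note Re_m = moments[OF Re_e borel_measurable_Re] and Im_m = moments[OF Im_e borel_measurable_Im]
  have mixed: "has_bochner_integral M (\<lambda>\<omega>. Re (e \<omega> $ k) * Im (e \<omega> $ l)) 0" if k: "k < m" and l: "l < m" for k l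
  proof -
    have "indep_var borel ((\<lambda>v. v $ k) \<circ> (\<lambda>\<omega>. map_vec Re (e \<omega>))) borel ((\<lambda>v. v $ l) \<circ> (\<lambda>\<omega>. map_vec Im (e \<omega>)))"
      by (rule indep_var_compose[OF indep measurable_vec_index[OF k] measurable_vec_index[OF l]])
    then have ind: "indep_var borel (\<lambda>\<omega>. map_vec Re (e \<omega>) $ k) borel (\<lambda>\<omega>. map_vec Im (e \<omega>) $ l)"
      by (simp add: comp_def)
    have Re_k: "has_bochner_integral M (\<lambda>\<omega>. map_vec Re (e \<omega>) $ k) 0"
      using Re_m(1)[OF k k] by (rule has_bochner_integral_cong[THEN iffD1, rotated -1]) (use dim k in auto)
    have Im_l: "has_bochner_integral M (\<lambda>\<omega>. map_vec Im (e \<omega>) $ l) 0"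
      using Im_m(1)[OF l l] by (rule has_bochner_integral_cong[THEN iffD1, rotated -1]) (use dim l in auto)
    have "has_bochner_integral M (\<lambda>\<omega>. map_vec Re (e \<omega>) $ k * map_vec Im (e \<omega>) $ l) 0"
      using Re_k Im_l indep_var_integrable[OF ind] indep_var_lebesgue_integral[OF ind]
      by (simp add: has_bochner_integral_iff)
    then show ?thesis
      by (rule has_bochner_integral_cong[THEN iffD1, rotated -1]) (use dim k l in auto)
  qed
  have "has_bochner_integral M (\<lambda>\<omega>. complex_of_real (Re (e \<omega> $ i)) + \<i> * complex_of_real (Im (e \<omega> $ i)))
      (complex_of_real 0 + \<i> * complex_of_real 0)"
    by (intro has_bochner_integral_add has_bochner_integral_mult_right has_bochner_integral_of_real
        Re_m(1)[OF i i] Im_m(1)[OF i i])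
  then show "has_bochner_integral M (\<lambda>\<omega>. e \<omega> $ i) 0"
    by (simp add: complex_eq[symmetric])
  have "has_bochner_integral M (\<lambda>\<omega>. (complex_of_real (Re (e \<omega> $ i) * Re (e \<omega> $ j)) +
        complex_of_real (Im (e \<omega> $ i) * Im (e \<omega> $ j))) +
        (\<i> * complex_of_real (Re (e \<omega> $ j) * Im (e \<omega> $ i)) - \<i> * complex_of_real (Re (e \<omega> $ i) * Im (e \<omega> $ j))))
      ((complex_of_real (if i = j then \<sigma>\<^sup>2 else 0) + complex_of_real (if i = j then \<sigma>\<^sup>2 else 0))
        + (\<i> * complex_of_real 0 - \<i> * complex_of_real 0))"
    by (intro has_bochner_integral_add has_bochner_integral_diff has_bochner_integral_mult_right
        has_bochner_integral_of_real Re_m(2)[OF i j] Im_m(2)[OF i j] mixed i j)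
  moreover have "z * cnj w = (complex_of_real (Re z * Re w) + complex_of_real (Im z * Im w)) +
      (\<i> * complex_of_real (Re w * Im z) - \<i> * complex_of_real (Re z * Im w))" for z w
    by (simp add: complex_eq_iff)
  ultimately show "has_bochner_integral M (\<lambda>\<omega>. e \<omega> $ i * cnj (e \<omega> $ j)) (if i = j then of_real (2 * \<sigma>\<^sup>2) else 0)"
    by (cases "i = j") simp_all
qed

text \<open>The squared modulus expands to a double sum of which only the diagonal survives
  integration. The computation is complex-valued and takes real parts at the end.\<close>

lemma has_bochner_integral_cmod_sum_orthogonal:
  fixes w :: "'i \<Rightarrow> 'w \<Rightarrow> complex" and s :: "'i \<Rightarrow> real"
  assumes I: "finite I"
    and w: "\<And>i j. i \<in> I \<Longrightarrow> j \<in> I \<Longrightarrow>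
      has_bochner_integral M (\<lambda>\<omega>. w i \<omega> * cnj (w j \<omega>)) (if i = j then complex_of_real (s i) else 0)"
  shows "has_bochner_integral M (\<lambda>\<omega>. (cmod (\<Sum>i\<in>I. c i * w i \<omega>))\<^sup>2) (\<Sum>i\<in>I. (cmod (c i))\<^sup>2 * s i)"
proof -
  have "has_bochner_integral M (\<lambda>\<omega>. \<Sum>i\<in>I. \<Sum>j\<in>I. (c i * cnj (c j)) * (w i \<omega> * cnj (w j \<omega>)))
      (\<Sum>i\<in>I. \<Sum>j\<in>I. (c i * cnj (c j)) * (if i = j then complex_of_real (s i) else 0))"
    by (intro has_bochner_integral_sum has_bochner_integral_mult_right w)
  moreover have "(\<Sum>i\<in>I. \<Sum>j\<in>I. (c i * cnj (c j)) * (w i \<omega> * cnj (w j \<omega>)))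
      = complex_of_real ((cmod (\<Sum>i\<in>I. c i * w i \<omega>))\<^sup>2)" for \<omega>
    unfolding complex_norm_square cnj_sum sum_product by (simp add: ac_simps)
  moreover have "(\<Sum>i\<in>I. \<Sum>j\<in>I. (c i * cnj (c j)) * (if i = j then complex_of_real (s i) else 0))
      = complex_of_real (\<Sum>i\<in>I. (cmod (c i))\<^sup>2 * s i)"
    using I by (simp add: mult_delta_right complex_norm_square del: of_real_power)
  ultimately have "has_bochner_integral M (\<lambda>\<omega>. complex_of_real ((cmod (\<Sum>i\<in>I. c i * w i \<omega>))\<^sup>2))
      (complex_of_real (\<Sum>i\<in>I. (cmod (c i))\<^sup>2 * s i))"
    by simp
  from has_bochner_integral_Re[OF this] show ?thesis by simp
qed

text \<open>The entries of \<open>x\<close> and \<open>e\<close> together form one orthogonal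
  family. The mean of \<open>x\<close> is arbitrary: cross terms factor by independence and vanish
  because \<open>e\<close> is centred.\<close>

lemma (in prob_space) mean_square_linear_combination:
  fixes x e :: "'a \<Rightarrow> complex vec"
  assumes x: "x \<in> measurable M (vec_borel N)"
    and x_moment: "mat N N (\<lambda>(i, j). \<integral>\<omega>. x \<omega> $ i * cnj (x \<omega> $ j) \<partial>M) = 1\<^sub>m N"
    and e: "e \<in> measurable M (vec_borel m)"
    and e_mean: "\<And>l. l < m \<Longrightarrow> has_bochner_integral M (\<lambda>\<omega>. e \<omega> $ l) 0"
    and e_cov: "\<And>i j. i < m \<Longrightarrow> j < m \<Longrightarrow>
      has_bochner_integral M (\<lambda>\<omega>. e \<omega> $ i * cnj (e \<omega> $ j)) (if i = j then complex_of_real s else 0)"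
    and indep: "indep_var (vec_borel N) x (vec_borel m) e"
  shows "has_bochner_integral M (\<lambda>\<omega>. (cmod ((\<Sum>k<N. p k * x \<omega> $ k) + (\<Sum>l<m. z l * e \<omega> $ l)))\<^sup>2)
    ((\<Sum>k<N. (cmod (p k))\<^sup>2) + s * (\<Sum>l<m. (cmod (z l))\<^sup>2))"
proof -
  have x_meas [measurable]: "(\<lambda>\<omega>. x \<omega> $ k) \<in> borel_measurable M" if "k < N" for k
    by (rule measurable_compose[OF x measurable_vec_index[OF that]])
  have cnj_borel: "cnj \<in> borel_measurable borel"
    by (intro borel_measurable_continuous_onI continuous_intros)
  have x_int: "(\<integral>\<omega>. x \<omega> $ i * cnj (x \<omega> $ j) \<partial>M) = (if i = j then 1 else 0)" if "i < N" "j < N" for i j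
    using arg_cong[OF x_moment, of "\<lambda>A. A $$ (i, j)"] that by simp
  \<comment> \<open>A non-integrable function has Bochner integral 0 by default, so the value 1 on
    the diagonal of the moment matrix certifies integrability.\<close>
  have x_sq: "integrable M (\<lambda>\<omega>. (cmod (x \<omega> $ k))\<^sup>2)" if "k < N" for k
  proof -
    have "integrable M (\<lambda>\<omega>. x \<omega> $ k * cnj (x \<omega> $ k))"
      using x_int[OF that that] not_integrable_integral_eq by fastforce
    from integrable_Re[OF this] show ?thesis by (simp add: cmod_power2 flip: power2_eq_square)
  qed
  \<comment> \<open>Off the diagonal the integral is 0 and tells nothing about integrability;
    domination by the two squares does.\<close>
  have x_prod: "integrable M (\<lambda>\<omega>. x \<omega> $ i * cnj (x \<omega> $ j))" if "i < N" "j < N" for i j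
  proof (rule Bochner_Integration.integrable_bound)
    show "integrable M (\<lambda>\<omega>. (cmod (x \<omega> $ i))\<^sup>2 + (cmod (x \<omega> $ j))\<^sup>2)"
      using x_sq that by simp
    have "u * v \<le> u\<^sup>2 + v\<^sup>2" if "0 \<le> u" "0 \<le> v" for u v :: real
      using sum_squares_bound[of u v] mult_nonneg_nonneg[OF that] by linarith
    then show "AE \<omega> in M. norm (x \<omega> $ i * cnj (x \<omega> $ j)) \<le> norm ((cmod (x \<omega> $ i))\<^sup>2 + (cmod (x \<omega> $ j))\<^sup>2)"
      by (simp add: norm_mult)
    show "(\<lambda>\<omega>. x \<omega> $ i * cnj (x \<omega> $ j)) \<in> borel_measurable M"
      using that by (intro borel_measurable_times measurable_compose[OF x_meas cnj_borel] x_meas)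
  qed
  have x_cov: "has_bochner_integral M (\<lambda>\<omega>. x \<omega> $ i * cnj (x \<omega> $ j)) (if i = j then 1 else 0)"
    if "i < N" "j < N" for i j
    using x_prod[OF that] x_int[OF that] by (simp add: has_bochner_integral_iff)
  \<comment> \<open>The product rule for independent variables asks for integrable factors; on a
    probability space the bound |u| \<le> 1 + |u|^2 suffices.\<close>
  have x_one: "integrable M (\<lambda>\<omega>. x \<omega> $ k)" if "k < N" for k
  proof (rule Bochner_Integration.integrable_bound)
    show "integrable M (\<lambda>\<omega>. 1 + (cmod (x \<omega> $ k))\<^sup>2)" using x_sq[OF that] by simp
    have "u \<le> 1 + u\<^sup>2" for u :: real
    proof -
      have "2 * u \<le> u\<^sup>2 + 1" using sum_squares_bound[of u 1] by simp
      then show ?thesis using zero_le_power2[of u] by linarith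
    qed
    then show "AE \<omega> in M. norm (x \<omega> $ k) \<le> norm (1 + (cmod (x \<omega> $ k))\<^sup>2)" by simp
  qed (use that in measurable)
  have mixed: "has_bochner_integral M (\<lambda>\<omega>. x \<omega> $ k * cnj (e \<omega> $ l)) 0" if k: "k < N" and l: "l < m" for k l
  proof -
    have cnj_meas: "(\<lambda>v. cnj (v $ l)) \<in> borel_measurable (vec_borel m)"
      by (rule measurable_compose[OF measurable_vec_index[OF l] cnj_borel])
    have "indep_var borel ((\<lambda>v. v $ k) \<circ> x) borel ((\<lambda>v. cnj (v $ l)) \<circ> e)"
      by (rule indep_var_compose[OF indep measurable_vec_index[OF k] cnj_meas])
    then have ind: "indep_var borel (\<lambda>\<omega>. x \<omega> $ k) borel (\<lambda>\<omega>. cnj (e \<omega> $ l))"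
      by (simp add: comp_def)
    have "integrable M (\<lambda>\<omega>. cnj (e \<omega> $ l))" "(\<integral>\<omega>. cnj (e \<omega> $ l) \<partial>M) = 0"
      using e_mean[OF l] by (simp_all add: has_bochner_integral_iff)
    then show ?thesis
      using indep_var_integrable[OF ind x_one[OF k]] indep_var_lebesgue_integral[OF ind x_one[OF k]]
      by (simp add: has_bochner_integral_iff)
  qed
  have mixed': "has_bochner_integral M (\<lambda>\<omega>. e \<omega> $ l * cnj (x \<omega> $ k)) 0" if "k < N" "l < m" for k l
    using has_bochner_integral_cnj[OF mixed[OF that]] by (simp add: mult.commute)
  \<comment> \<open>The disjoint sum of the index sets merges both vectors into one family, with
    second moments 1 and \<open>s\<close>.\<close>
  let ?I = "{..<N} <+> {..<m}"
  define w where "w = (\<lambda>k \<omega>. case k of Inl k \<Rightarrow> x \<omega> $ k | Inr l \<Rightarrow> e \<omega> $ l)"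
  define c where "c = (\<lambda>k. case k of Inl k \<Rightarrow> p k | Inr l \<Rightarrow> z l)"
  define v where "v = (\<lambda>k::nat + nat. case k of Inl _ \<Rightarrow> 1 | Inr _ \<Rightarrow> s)"
  have "has_bochner_integral M (\<lambda>\<omega>. w i \<omega> * cnj (w j \<omega>)) (if i = j then complex_of_real (v i) else 0)"
    if "i \<in> ?I" "j \<in> ?I" for i j
    using that
  proof (elim PlusE)
    fix k l assume "i = Inl k" "k \<in> {..<N}" "j = Inl l" "l \<in> {..<N}"
    then show ?thesis using x_cov[of k l] by (cases "k = l") (simp_all add: w_def v_def)
  next
    fix k l assume "i = Inl k" "k \<in> {..<N}" "j = Inr l" "l \<in> {..<m}"
    then show ?thesis using mixed[of k l] by (simp add: w_def v_def)
  next
    fix k l assume "i = Inr l" "l \<in> {..<m}" "j = Inl k" "k \<in> {..<N}"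
    then show ?thesis using mixed'[of k l] by (simp add: w_def v_def)
  next
    fix k l assume "i = Inr k" "k \<in> {..<m}" "j = Inr l" "l \<in> {..<m}"
    then show ?thesis using e_cov[of k l] by (cases "k = l") (simp_all add: w_def v_def)
  qed
  then have "has_bochner_integral M (\<lambda>\<omega>. (cmod (\<Sum>i\<in>?I. c i * w i \<omega>))\<^sup>2) (\<Sum>i\<in>?I. (cmod (c i))\<^sup>2 * v i)"
    by (intro has_bochner_integral_cmod_sum_orthogonal) auto
  then show ?thesis
    by (simp add: sum.Plus comp_def w_def c_def v_def sum_distrib_left mult.commute[of _ s])
qed

section \<open>Characters and the equispaced Fourier matrix\<close>

definition fourier_char :: "int \<Rightarrow> real \<Rightarrow> complex" where
  "fourier_char d s = exp (2 * complex_of_real pi * \<i> * of_int d * of_real s)"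

lemma fourier_char_eq_cis: "fourier_char d s = cis (2 * pi * of_int d * s)"
  by (simp add: fourier_char_def cis_conv_exp mult_ac)

lemma fourier_char_cnj_mult: "cnj (fourier_char d s) * fourier_char d' s = fourier_char (d' - d) s"
  by (simp add: fourier_char_eq_cis cis_cnj cis_mult algebra_simps)

lemma fourier_char_add: "fourier_char d (s + s') = fourier_char d s * fourier_char d s'"
  by (simp add: fourier_char_eq_cis cis_mult algebra_simps)

lemma cmod_fourier_char [simp]: "cmod (fourier_char d s) = 1"
  by (simp add: fourier_char_eq_cis)

text \<open>A chord is no longer than its arc: |exp(i \<theta>) - 1| = 2 |sin(\<theta>/2)| \<le>
  |\<theta>|.\<close>

lemma cmod_fourier_char_minus_one_le: "cmod (fourier_char d s - 1) \<le> 2 * pi * \<bar>of_int d\<bar> * \<bar>s\<bar>"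
proof -
  have "cmod (fourier_char d s - 1) = 2 * \<bar>sin (2 * pi * of_int d * s / 2)\<bar>"
    using dist_exp_i_1[of "2 * pi * of_int d * s"] by (simp add: fourier_char_eq_cis cis_conv_exp)
  also have "\<dots> \<le> 2 * \<bar>2 * pi * of_int d * s / 2\<bar>"
    by (intro mult_left_mono abs_sin_x_le_abs_x) simp
  finally show ?thesis by (simp add: abs_mult)
qed

text \<open>A geometric sum whose ratio is an m-th root of unity; the ratio is 1 exactly when m
  divides d.\<close>

lemma sum_fourier_char:
  assumes m: "0 < m"
  shows "(\<Sum>l<m. fourier_char d (real l / real m)) = (if int m dvd d then of_nat m else 0)"
proof -
  define z where "z = fourier_char d (1 / real m)"
  have pow: "fourier_char d (real l / real m) = z ^ l" for l
  proof -
    have "2 * pi * of_int d * (real l / real m) = real l * (2 * pi * of_int d * (1 / real m))" by simp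
    then show ?thesis unfolding z_def fourier_char_eq_cis by (simp only: Complex.DeMoivre)
  qed
  have "z ^ m = fourier_char d 1" using m pow[of m] by simp
  also have "\<dots> = 1"
    using cis_multiple_2pi[of "of_int d"] by (simp add: fourier_char_eq_cis)
  finally have zm: "z ^ m = 1" .
  show ?thesis
  proof (cases "int m dvd d")
    case True
    then obtain c where d: "d = int m * c" ..
    have "2 * pi * of_int d * (1 / real m) = 2 * pi * of_int c" using m by (simp add: d)
    then have "z = cis (2 * pi * of_int c)" unfolding z_def fourier_char_eq_cis by (simp only:)
    then have "z = 1" by (simp only: cis_multiple_2pi Ints_of_int)
    then show ?thesis using True by (simp add: pow)
  next
    case False
    have "z \<noteq> 1"
    proof
      assume "z = 1"
      \<comment> \<open>The real part suffices: a cosine equal to 1 forces an integer multiple of 2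
        pi, and cancelling pi yields divisibility.\<close>
      then have "cos (2 * pi * of_int d / real m) = 1"
        by (simp add: z_def fourier_char_eq_cis complex_eq_iff)
      then obtain c :: int where "2 * pi * of_int d / real m = of_int c * 2 * pi"
        unfolding cos_one_2pi_int by blast
      then have "real_of_int d = real_of_int (int m * c)"
        using m by (simp add: field_simps)
      then have "d = int m * c" by (simp only: of_int_eq_iff)
      with False show False by simp
    qed
    then have "(\<Sum>l<m. z ^ l) = 0" using zm geometric_sum[of z m] by simp
    then show ?thesis using False by (simp add: pow)
  qed
qed

lemma dvd_diff_iff_mod_eq:
  assumes "r < m"
  shows "int m dvd int k - int r \<longleftrightarrow> k mod m = r"
  using assms by (metis mod_eq_dvd_iff mod_less of_nat_eq_iff zmod_int)

lemma fourier_mat_carrier: "fourier_mat m q t \<in> carrier_mat m (2 * q + 1)"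
  by (simp add: fourier_mat_def)

lemma fourier_mat_index:
  assumes "i < m" "j < 2 * q + 1"
  shows "fourier_mat m q t $$ (i, j) = fourier_char (int j - int q) (t (i + 1))"
  using assms by (simp add: fourier_mat_def fourier_char_def)

text \<open>The model without jitter. Sample points are counted from 1, so the grid starts at
  0.\<close>

definition equispaced_mat :: "nat \<Rightarrow> nat \<Rightarrow> complex mat" where
  "equispaced_mat m q = fourier_mat m q (\<lambda>l. (real l - 1) / real m)"

lemma equispaced_mat_carrier: "equispaced_mat m q \<in> carrier_mat m (2 * q + 1)"
  unfolding equispaced_mat_def by (rule fourier_mat_carrier)

lemma equispaced_mat_index:
  assumes "i < m" "j < 2 * q + 1"
  shows "equispaced_mat m q $$ (i, j) = fourier_char (int j - int q) (real i / real m)"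
  using assms by (simp add: equispaced_mat_def fourier_mat_index)

text \<open>Moving a sample point by at most T changes an entry by at most 2 pi q T \<le> pi N T;
  there are m N entries, which accounts for the factor sqrt m and the power 3/2 of N.\<close>

lemma frobenius_sq_fourier_mat_minus_equispaced:
  assumes t: "\<And>l. l \<in> {1..m} \<Longrightarrow> \<bar>t l - (real l - 1) / real m\<bar> \<le> T" and N: "N = 2 * q + 1"
  shows "frobenius_sq (fourier_mat m q t - equispaced_mat m q) \<le> (pi * sqrt (real m) * real N powr (3 / 2) * T)\<^sup>2"
proof -
  let ?D = "fourier_mat m q t - equispaced_mat m q"
  have D: "?D \<in> carrier_mat m N"
    using fourier_mat_carrier[of m q t] equispaced_mat_carrier[of m q] N by (simp add: minus_carrier_mat)
  have entry: "(cmod (?D $$ (i, j)))\<^sup>2 \<le> (pi * real N * T)\<^sup>2" if ij: "i < m" "j < N" for i j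
  proof (rule power_mono)
    define s where "s = t (i + 1) - real i / real m"
    have s: "\<bar>s\<bar> \<le> T" using t[of "i + 1"] ij by (simp add: s_def)
    have j: "\<bar>real_of_int (int j - int q)\<bar> \<le> real q" using ij N by auto
    have "?D $$ (i, j) = fourier_char (int j - int q) (real i / real m + s) - fourier_char (int j - int q) (real i / real m)"
      using ij N fourier_mat_carrier[of m q t] equispaced_mat_carrier[of m q]
      by (simp add: fourier_mat_index equispaced_mat_index s_def)
    also have "\<dots> = fourier_char (int j - int q) (real i / real m) * (fourier_char (int j - int q) s - 1)"
      by (simp add: fourier_char_add algebra_simps)
    finally have "cmod (?D $$ (i, j)) = cmod (fourier_char (int j - int q) s - 1)"
      by (simp add: norm_mult)
    also have "\<dots> \<le> 2 * pi * \<bar>real_of_int (int j - int q)\<bar> * \<bar>s\<bar>"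
      by (rule cmod_fourier_char_minus_one_le)
    also have "\<dots> \<le> 2 * pi * real q * T"
      using j s by (intro mult_mono) auto
    also have "\<dots> = pi * T * (2 * real q)" by simp
    also have "\<dots> \<le> pi * T * real N"
      using N s by (intro mult_left_mono) auto
    finally show "cmod (?D $$ (i, j)) \<le> pi * real N * T" by (simp add: mult_ac)
  qed simp
  have "frobenius_sq ?D \<le> (\<Sum>i<m. \<Sum>j<N. (pi * real N * T)\<^sup>2)"
    unfolding frobenius_sq_def carrier_matD[OF D] by (intro sum_mono entry) auto
  also have "\<dots> = real m * real N * (pi * real N * T)\<^sup>2" by simp
  also have "\<dots> = (pi * sqrt (real m) * (real N * sqrt (real N)) * T)\<^sup>2"
    by (simp add: power_mult_distrib mult_ac)
  also have "real N * sqrt (real N) = real N powr (3 / 2)"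
    using powr_add[of "real N" 1 "1 / 2"] by (simp add: powr_half_sqrt)
  finally show ?thesis .
qed

text \<open>Two columns are orthogonal unless m divides the difference of their frequencies. With N
  \<le> m this happens only on the diagonal.\<close>

lemma equispaced_mat_gram_columns:
  assumes m: "0 < m" and N: "N = 2 * q + 1" and Nm: "N \<le> m"
  shows "mat_adjoint (equispaced_mat m q) * equispaced_mat m q = mat_diag N (\<lambda>_. complex_of_real (real m))"
proof (rule eq_matI)
  let ?F = "equispaced_mat m q"
  have F: "?F \<in> carrier_mat m N" using equispaced_mat_carrier N by simp
  note F' = mat_adjoint_carrier[OF F]
  show "dim_row (mat_adjoint ?F * ?F) = dim_row (mat_diag N (\<lambda>_. complex_of_real (real m)))"
    "dim_col (mat_adjoint ?F * ?F) = dim_col (mat_diag N (\<lambda>_. complex_of_real (real m)))"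
    using F F' by (auto simp: mat_diag_def)
  fix i j assume "i < dim_row (mat_diag N (\<lambda>_. complex_of_real (real m)))"
    "j < dim_col (mat_diag N (\<lambda>_. complex_of_real (real m)))"
  then have ij: "i < N" "j < N" by (auto simp: mat_diag_def)
  have "(mat_adjoint ?F * ?F) $$ (i, j) = (\<Sum>l<m. cnj (?F $$ (l, i)) * ?F $$ (l, j))"
    using F F' ij by (simp add: scalar_prod_def lessThan_atLeast0 mat_adjoint_index[OF F])
  also have "\<dots> = (\<Sum>l<m. fourier_char (int j - int i) (real l / real m))"
    using ij N by (simp add: equispaced_mat_index fourier_char_cnj_mult)
  also have "\<dots> = (if int m dvd int j - int i then of_nat m else 0)" by (rule sum_fourier_char[OF m])
  also have "int m dvd int j - int i \<longleftrightarrow> i = j"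
    using ij Nm dvd_diff_iff_mod_eq[of i m j] by auto
  finally show "(mat_adjoint ?F * ?F) $$ (i, j) = mat_diag N (\<lambda>_. complex_of_real (real m)) $$ (i, j)"
    using ij by (simp add: mat_diag_def)
qed

text \<open>
  The frequencies are shifted by \<open>q\<close>, so that column \<open>k\<close> of the equispaced matrix is
  \<open>sqrt m\<close> times column \<open>k mod m\<close> of this unitary matrix.
\<close>

definition shifted_dft :: "nat \<Rightarrow> nat \<Rightarrow> complex mat" where
  "shifted_dft m q = mat m m (\<lambda>(l, r). fourier_char (int r - int q) (real l / real m) / sqrt (real m))"

text \<open>The equispaced matrix in the basis of \<open>shifted_dft\<close>: frequencies congruent
  modulo m alias on the grid, so each column has one nonzero entry.\<close>

definition residue_mat :: "nat \<Rightarrow> nat \<Rightarrow> complex mat" where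
  "residue_mat m n = mat m n (\<lambda>(r, k). if k mod m = r then complex_of_real (sqrt (real m)) else 0)"

lemma shifted_dft_carrier: "shifted_dft m q \<in> carrier_mat m m"
  by (simp add: shifted_dft_def)

lemma residue_mat_carrier: "residue_mat m n \<in> carrier_mat m n"
  by (simp add: residue_mat_def)

lemma shifted_dft_unitary:
  assumes m: "0 < m"
  shows "mat_adjoint (shifted_dft m q) * shifted_dft m q = 1\<^sub>m m"
    and "shifted_dft m q * mat_adjoint (shifted_dft m q) = 1\<^sub>m m"
proof -
  let ?U = "shifted_dft m q"
  note U = shifted_dft_carrier[of m q]
  note U' = mat_adjoint_carrier[OF U]
  show *: "mat_adjoint ?U * ?U = 1\<^sub>m m"
  proof (rule eq_matI)
    fix r s assume "r < dim_row (1\<^sub>m m :: complex mat)" "s < dim_col (1\<^sub>m m :: complex mat)"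
    then have rs: "r < m" "s < m" by auto
    have "(mat_adjoint ?U * ?U) $$ (r, s) = (\<Sum>l<m. cnj (?U $$ (l, r)) * ?U $$ (l, s))"
      using U U' rs by (simp add: scalar_prod_def lessThan_atLeast0 mat_adjoint_index[OF U])
    also have "\<dots> = (\<Sum>l<m. fourier_char (int s - int r) (real l / real m) / of_nat m)"
    proof (rule sum.cong)
      fix l assume "l \<in> {..<m}"
      have "complex_of_real (sqrt (real m)) * complex_of_real (sqrt (real m)) = of_nat m"
        by (simp flip: of_real_mult)
      then show "cnj (?U $$ (l, r)) * ?U $$ (l, s) = fourier_char (int s - int r) (real l / real m) / of_nat m"
        using rs \<open>l \<in> {..<m}\<close> fourier_char_cnj_mult[of "int r - int q" "real l / real m" "int s - int q"]
        by (simp add: shifted_dft_def times_divide_times_eq)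
    qed simp
    also have "\<dots> = (if s = r then 1 else 0)"
      unfolding sum_divide_distrib[symmetric] sum_fourier_char[OF m] dvd_diff_iff_mod_eq[OF rs(1)]
      using m rs by simp
    finally show "(mat_adjoint ?U * ?U) $$ (r, s) = 1\<^sub>m m $$ (r, s)" using rs by auto
  qed (use U U' in auto)
  show "?U * mat_adjoint ?U = 1\<^sub>m m"
    by (rule mat_mult_left_right_inverse[OF U' U *])
qed

text \<open>The shifts by \<open>q\<close> cancel in the product of two characters, so the geometric
  sum depends on k - r only, and the residue of the column index, not of the frequency, selects the
  row.\<close>

lemma shifted_dft_adjoint_mult_equispaced_mat:
  assumes m: "0 < m"
  shows "mat_adjoint (shifted_dft m q) * equispaced_mat m q = residue_mat m (2 * q + 1)"
proof (rule eq_matI)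
  let ?U = "shifted_dft m q" and ?F = "equispaced_mat m q"
  note U = shifted_dft_carrier[of m q] and F = equispaced_mat_carrier[of m q]
  note U' = mat_adjoint_carrier[OF U]
  fix r k assume "r < dim_row (residue_mat m (2 * q + 1))" "k < dim_col (residue_mat m (2 * q + 1))"
  then have rk: "r < m" "k < 2 * q + 1" by (auto simp: residue_mat_def)
  have "(mat_adjoint ?U * ?F) $$ (r, k) = (\<Sum>l<m. cnj (?U $$ (l, r)) * ?F $$ (l, k))"
    using U U' F rk by (simp add: scalar_prod_def lessThan_atLeast0 mat_adjoint_index[OF U])
  also have "\<dots> = (\<Sum>l<m. fourier_char (int k - int r) (real l / real m) / sqrt (real m))"
  proof (rule sum.cong)
    fix l assume "l \<in> {..<m}"
    then show "cnj (?U $$ (l, r)) * ?F $$ (l, k) = fourier_char (int k - int r) (real l / real m) / sqrt (real m)"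
      using rk fourier_char_cnj_mult[of "int r - int q" "real l / real m" "int k - int q"]
      by (simp add: shifted_dft_def equispaced_mat_index)
  qed simp
  also have "\<dots> = (if k mod m = r then of_nat m / complex_of_real (sqrt (real m)) else 0)"
    unfolding sum_divide_distrib[symmetric] sum_fourier_char[OF m] dvd_diff_iff_mod_eq[OF rk(1)] by simp
  also have "of_nat m / complex_of_real (sqrt (real m)) = complex_of_real (sqrt (real m))"
    by (metis of_real_divide of_real_of_nat_eq real_div_sqrt of_nat_0_le_iff)
  finally show "(mat_adjoint ?U * ?F) $$ (r, k) = residue_mat m (2 * q + 1) $$ (r, k)"
    using rk by (simp add: residue_mat_def)
qed (use mat_adjoint_carrier[OF shifted_dft_carrier[of m q]] equispaced_mat_carrier[of m q] in \<open>auto simp: residue_mat_def\<close>)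

text \<open>Each of the \<open>a\<close> complete blocks of length m contains every residue once;
  the last \<open>b\<close> numbers contain just the residues below \<open>b\<close>.\<close>

lemma card_residue_class:
  fixes a b m r :: nat
  assumes r: "r < m" and b: "b < m"
  shows "card {k. k < a * m + b \<and> k mod m = r} = a + (if r < b then 1 else 0)"
proof -
  let ?c = "a + (if r < b then 1 else 0)"
  have "{k. k < a * m + b \<and> k mod m = r} = (\<lambda>i. i * m + r) ` {..<?c}"
  proof (rule equalityI; rule subsetI)
    fix k assume "k \<in> {k. k < a * m + b \<and> k mod m = r}"
    then obtain i where k: "k < a * m + b" "k = i * m + r"
      by (metis (mono_tags, lifting) div_mult_mod_eq mem_Collect_eq)
    have "i < ?c"
    proof (rule ccontr)
      assume "\<not> i < ?c"
      then have "?c * m \<le> i * m" by (intro mult_le_mono1) simp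
      then have le: "a * m + (if r < b then m else 0) \<le> i * m"
        by (simp only: add_mult_distrib if_distrib[of "\<lambda>x. x * m"] mult_1 mult_0)
      show False
      proof (cases "r < b")
        case True
        with le have "a * m + m \<le> i * m" by (simp only: if_True)
        with k b show False by linarith
      next
        case False
        with le have "a * m \<le> i * m" by (simp only: if_False add_0_right)
        with k False show False by linarith
      qed
    qed
    then show "k \<in> (\<lambda>i. i * m + r) ` {..<?c}" using k(2) by blast
  next
    fix k assume "k \<in> (\<lambda>i. i * m + r) ` {..<?c}"
    then obtain i where i: "i < ?c" "k = i * m + r" by blast
    have "k < a * m + b"
    proof (cases "i < a")
      case True
      then have "Suc i * m \<le> a * m" by (intro mult_le_mono1) simp
      then show ?thesis using i r by simp
    next
      case False
      then show ?thesis using i by (auto split: if_splits simp: less_Suc_eq)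
    qed
    then show "k \<in> {k. k < a * m + b \<and> k mod m = r}" using i r by simp
  qed
  moreover have "inj_on (\<lambda>i. i * m + r) {..<?c}" using r by (auto simp: inj_on_def)
  ultimately show ?thesis by (simp add: card_image)
qed

text \<open>Different rows have disjoint supports, and row \<open>r\<close> carries the value sqrt m
  on the \<open>r\<close>-th residue class.\<close>

lemma residue_mat_gram:
  assumes m: "0 < m" and b: "b < m" and n: "n = a * m + b"
  shows "residue_mat m n * mat_adjoint (residue_mat m n) =
    mat_diag m (\<lambda>r. complex_of_real (real m * (real a + (if r < b then 1 else 0))))"
    (is "?R * _ = mat_diag m ?d")
proof (rule eq_matI)
  note R = residue_mat_carrier[of m n]
  note R' = mat_adjoint_carrier[OF R]
  show "dim_row (?R * mat_adjoint ?R) = dim_row (mat_diag m ?d)"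
    "dim_col (?R * mat_adjoint ?R) = dim_col (mat_diag m ?d)"
    using R R' by (auto simp: mat_diag_def)
  fix r s assume "r < dim_row (mat_diag m ?d)" "s < dim_col (mat_diag m ?d)"
  then have rs: "r < m" "s < m" by (auto simp: mat_diag_def)
  have sq: "complex_of_real (sqrt (real m)) * complex_of_real (sqrt (real m)) = of_nat m"
    by (simp flip: of_real_mult)
  have "(?R * mat_adjoint ?R) $$ (r, s) = (\<Sum>k<n. ?R $$ (r, k) * cnj (?R $$ (s, k)))"
    using R R' rs by (simp add: scalar_prod_def lessThan_atLeast0 mat_adjoint_index[OF R])
  also have "\<dots> = (\<Sum>k<n. if k mod m = r then (if r = s then of_nat m else 0) else 0)"
    using rs by (intro sum.cong) (auto simp: residue_mat_def sq)
  also have "\<dots> = (\<Sum>k \<in> {k. k < n \<and> k mod m = r}. if r = s then of_nat m else 0)"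
    by (intro sum.mono_neutral_cong_right) auto
  also have "\<dots> = of_nat (card {k. k < n \<and> k mod m = r}) * (if r = s then of_nat m else 0)"
    by simp
  also have "\<dots> = mat_diag m ?d $$ (r, s)"
    unfolding n card_residue_class[OF rs(1) b] using rs by (simp add: mat_diag_def)
  finally show "(?R * mat_adjoint ?R) $$ (r, s) = mat_diag m ?d $$ (r, s)" .
qed

section \<open>Size of the perturbation\<close>

text \<open>The quantity to be bounded is (\<alpha> + \<beta>)^2 - \<alpha>^2.\<close>

lemma eta_less_of_root_sum_less:
  fixes \<alpha> \<beta> c :: real
  assumes "0 \<le> \<alpha>" "0 \<le> \<beta>" "\<alpha> + \<beta> < sqrt c"
  shows "2 * \<alpha> * \<beta> + \<beta>\<^sup>2 < c - \<alpha>\<^sup>2"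
proof -
  \<comment> \<open>The real \<open>sqrt\<close> is negative at negative arguments, so a positive
    root forces a positive argument.\<close>
  have c: "0 \<le> c"
    using assms by (smt (verit) real_sqrt_ge_0_iff)
  have "(\<alpha> + \<beta>)\<^sup>2 < (sqrt c)\<^sup>2" using assms by (intro power_strict_mono) auto
  then show ?thesis using c by (simp add: power2_eq_square algebra_simps)
qed

text \<open>Identifies the ceiling in \<alpha> with the size of the largest residue class, hence
  \<alpha>^2 with the largest diagonal entry of the unperturbed Gram matrix.\<close>

lemma ceiling_divide_nat:
  fixes a b m :: nat
  assumes m: "0 < m" and b: "b < m"
  shows "\<lceil>real (a * m + b) / real m\<rceil> = int a + (if b = 0 then 0 else 1)"
proof (rule ceiling_unique)
  have "real (a * m + b) / real m = real a + real b / real m"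
    using m by (simp add: field_simps)
  moreover have "0 \<le> real b / real m" "real b / real m < 1" "b \<noteq> 0 \<Longrightarrow> 0 < real b / real m"
    using m b by simp_all
  ultimately show "real_of_int (int a + (if b = 0 then 0 else 1)) - 1 < real (a * m + b) / real m"
    and "real (a * m + b) / real m \<le> real_of_int (int a + (if b = 0 then 0 else 1))"
    by auto
qed

text \<open>The claim amounts to sqrt m + \<beta> < sqrt (2 m), that is \<beta> < (sqrt 2 - 1) sqrt
  m. Since 1 / (sqrt 2 + 1) = sqrt 2 - 1, this is the bound on T in another form.\<close>

lemma overdetermined_eta_less:
  fixes m N T \<beta> :: real
  assumes m: "0 < m" and N: "0 < N" and T: "0 < T"
    and bound: "T < 1 / ((sqrt 2 + 1) * pi * N powr (3 / 2))"
    and \<beta>: "\<beta> = pi * sqrt m * N powr (3 / 2) * T"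
  shows "2 * sqrt m * \<beta> + \<beta>\<^sup>2 < m"
proof -
  have pos: "0 < N powr (3 / 2)" using N by simp
  have rat: "(sqrt 2 + 1) * (sqrt 2 - 1) = (1 :: real)" by (simp add: algebra_simps)
  have "T * ((sqrt 2 + 1) * pi * N powr (3 / 2)) < 1"
    using bound pos by (simp add: pos_less_divide_eq add_pos_pos)
  then have "(pi * N powr (3 / 2) * T) * (sqrt 2 + 1) < (sqrt 2 - 1) * (sqrt 2 + 1)"
    using rat by (simp add: mult_ac)
  then have "pi * N powr (3 / 2) * T < sqrt 2 - 1"
    by (rule mult_right_less_imp_less) simp
  then have "sqrt m * (pi * N powr (3 / 2) * T) < sqrt m * (sqrt 2 - 1)"
    using m by simp
  then have "sqrt m + \<beta> < sqrt (2 * m)"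
    by (simp add: \<beta> algebra_simps real_sqrt_mult)
  moreover have "0 \<le> \<beta>" using m N T by (simp add: \<beta>)
  ultimately show ?thesis
    using eta_less_of_root_sum_less[of "sqrt m" \<beta> "2 * m"] m by simp
qed

text \<open>\<eta> has to stay below the smallest diagonal entry m a, which means \<alpha> + \<beta>
  < sqrt (m a + \<alpha>^2). The given bound on \<beta> depends on N and m only, so it has to be
  compared with sqrt (m a + \<alpha>^2) - \<alpha>.\<close>

lemma underdetermined_eta_less:
  fixes a b m :: nat and \<beta> :: real
  assumes m: "0 < m" and b: "b < m" and a: "1 \<le> a" and N: "N = a * m + b"
    and \<beta>: "0 \<le> \<beta>" "\<beta> < sqrt (2 * real N) - sqrt (real N + real m)"
    and \<alpha>: "\<alpha> = sqrt (real m * (real a + (if b = 0 then 0 else 1)))"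
  shows "2 * \<alpha> * \<beta> + \<beta>\<^sup>2 < real m * real a"
proof -
  define S where "S = real N + real m"
  define R where "R = real m * real a + \<alpha>\<^sup>2"
  have am: "real m \<le> real m * real a" using mult_left_mono[of 1 "real a" "real m"] a by simp
  have N': "real N = real m * real a + real b" by (simp add: N)
  have \<alpha>0: "0 \<le> \<alpha>" by (simp add: \<alpha>)
  have \<alpha>2: "\<alpha>\<^sup>2 = real m * real a + (if b = 0 then 0 else real m)"
    by (simp add: \<alpha> algebra_simps)
  have S0: "0 \<le> S" and R0: "0 \<le> R" by (simp_all add: S_def R_def)
  have "\<alpha>\<^sup>2 \<le> S" using b by (simp add: \<alpha>2 S_def N')
  then have \<alpha>S: "\<alpha> \<le> sqrt S" using \<alpha>0 by (simp add: real_le_rsqrt)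
  text \<open>
    The case of interest is \<open>R < 2 * N\<close> with \<open>b > 0\<close>: rationalising both sides turns the
    claim into the comparison of \<open>(2 * b - m) / (sqrt (2 * N) + sqrt R)\<close> and
    \<open>b / (sqrt S + \<alpha>)\<close>.
  \<close>
  have "sqrt (2 * real N) - sqrt R \<le> sqrt S - \<alpha>"
  proof (rule ccontr)
    let ?u = "sqrt (2 * real N) - sqrt R" and ?P = "sqrt (2 * real N) + sqrt R"
      and ?v = "sqrt S - \<alpha>" and ?Q = "sqrt S + \<alpha>"
    assume "\<not> ?u \<le> ?v"
    then have uv: "?v < ?u" by simp
    have "m \<le> N" using mult_le_mono1[OF a, of m] unfolding N by linarith
    then have "S \<le> 2 * real N" by (simp add: S_def)
    moreover have "\<alpha>\<^sup>2 \<le> R" by (simp add: R_def)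
    ultimately have QP: "?Q \<le> ?P" using \<alpha>0 by (intro add_mono real_sqrt_le_mono real_le_rsqrt) auto
    have "0 < S" using m by (simp add: S_def)
    then have Q: "0 < ?Q" using \<alpha>0 by (simp add: add_pos_nonneg)
    \<comment> \<open>Both ends are differences of squares, and the chain yields S - \<alpha>^2 < 2
      N - R. This reads m < 0 if b = 0 and b < 2 b - m otherwise, against b < m.\<close>
    have "?v * ?Q < ?u * ?Q" using uv Q by simp
    also have "\<dots> \<le> ?u * ?P"
    proof (rule mult_left_mono[OF QP])
      show "0 \<le> ?u" using uv \<alpha>S by linarith
    qed
    also have "?u * ?P = 2 * real N - R" using R0 by (simp add: algebra_simps)
    also have "?v * ?Q = S - \<alpha>\<^sup>2" using S0 by (simp add: algebra_simps power2_eq_square)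
    finally show False using b am by (simp add: S_def R_def \<alpha>2 N' split: if_splits)
  qed
  then have "\<alpha> + \<beta> < sqrt R" using \<beta> by (simp add: S_def)
  from eta_less_of_root_sum_less[OF \<alpha>0 \<beta>(1) this] show ?thesis by (simp add: R_def)
qed

lemma sum_split_eigenvalues:
  fixes f :: "real \<Rightarrow> real"
  assumes "b \<le> m"
  shows "(\<Sum>r<m. f (if r < b then u else v)) = real b * f u + (real m - real b) * f v"
proof -
  have "{..<m} = {..<b} \<union> {b..<m}" "{..<b} \<inter> {b..<m} = {}" using assms by auto
  then have "(\<Sum>r<m. f (if r < b then u else v))
      = (\<Sum>r<b. f (if r < b then u else v)) + (\<Sum>r\<in>{b..<m}. f (if r < b then u else v))"
    by (simp add: sum.union_disjoint)
  also have "(\<Sum>r<b. f (if r < b then u else v)) = real b * f u" by simp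
  also have "(\<Sum>r\<in>{b..<m}. f (if r < b then u else v)) = (real m - real b) * f v"
    using assms by (simp add: of_nat_diff)
  finally show ?thesis .
qed

text \<open>Substituting m a = N - b in the common numerator produces a factor m, which cancels.
  \<eta> may have either sign, so one identity serves both bounds.\<close>

lemma two_eigenvalue_trace:
  fixes m a b N \<eta> :: real
  assumes "0 < m" "N = m * a + b" "m * a + \<eta> \<noteq> 0" "m * (a + 1) + \<eta> \<noteq> 0"
  shows "(b * (1 / (m * (a + 1) + \<eta>)) + (m - b) * (1 / (m * a + \<eta>))) / m
    = (N + m + \<eta> - 2 * b) / ((m * a + \<eta>) * (m * (a + 1) + \<eta>))"
proof -
  have "b * (1 / (m * (a + 1) + \<eta>)) + (m - b) * (1 / (m * a + \<eta>))
      = (b * (m * a + \<eta>) + (m - b) * (m * (a + 1) + \<eta>)) / ((m * a + \<eta>) * (m * (a + 1) + \<eta>))"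
    using assms by (simp add: add_frac_eq mult.commute)
  also have "b * (m * a + \<eta>) + (m - b) * (m * (a + 1) + \<eta>) = m * (N + m + \<eta> - 2 * b)"
    using assms by (simp add: algebra_simps)
  finally show ?thesis using assms by simp
qed

section \<open>The mean square error\<close>

text \<open>Each coordinate of the error is a linear combination of the entries of \<open>x\<close>
  and \<open>e\<close>, with a row of X A - 1 and a row of X as coefficients. Adding up the mean
  squares gives Frobenius norms.\<close>

lemma (in prob_space) mean_square_reconstruction_error:
  fixes x e :: "'a \<Rightarrow> complex vec"
  assumes A: "A \<in> carrier_mat m N" and X: "X \<in> carrier_mat N m"
    and m: "0 < m" and \<epsilon>: "0 < \<epsilon>"
    and x: "x \<in> measurable M (vec_borel N)"
    and x_moment: "mat N N (\<lambda>(i, j). \<integral>\<omega>. x \<omega> $ i * cnj (x \<omega> $ j) \<partial>M) = 1\<^sub>m N"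
    and e: "e \<in> measurable M (vec_borel m)"
    and Re_e: "distr M (vec_borel m) (\<lambda>\<omega>. map_vec Re (e \<omega>)) = gaussian_vec m (sqrt (\<epsilon>\<^sup>2 / (2 * real m)))"
    and Im_e: "distr M (vec_borel m) (\<lambda>\<omega>. map_vec Im (e \<omega>)) = gaussian_vec m (sqrt (\<epsilon>\<^sup>2 / (2 * real m)))"
    and indep_Re_Im: "indep_var
      (vec_borel m) (\<lambda>\<omega>. map_vec Re (e \<omega>)) (vec_borel m) (\<lambda>\<omega>. map_vec Im (e \<omega>))"
    and indep_x_e: "indep_var (vec_borel N) x (vec_borel m) e"
  shows "(\<integral>\<omega>. (cvec_norm (X *\<^sub>v (A *\<^sub>v x \<omega> + e \<omega>) - x \<omega>))\<^sup>2 \<partial>M)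
    = frobenius_sq (X * A - 1\<^sub>m N) + \<epsilon>\<^sup>2 / real m * frobenius_sq X"
proof -
  define s where "s = \<epsilon>\<^sup>2 / real m"
  define P where "P = X * A - 1\<^sub>m N"
  have XA: "X * A \<in> carrier_mat N N" using X A by simp
  have P: "P \<in> carrier_mat N N" by (simp add: P_def minus_carrier_mat)
  have \<sigma>: "0 < sqrt (\<epsilon>\<^sup>2 / (2 * real m))" using m \<epsilon> by simp
  note e_moments = white_noise_covariance[OF \<sigma> e Re_e Im_e indep_Re_Im]
  \<comment> \<open>The real and the imaginary part each contribute \<epsilon>^2 / (2 m).\<close>
  have "2 * (sqrt (\<epsilon>\<^sup>2 / (2 * real m)))\<^sup>2 = s" using m by (simp add: s_def)
  then have e_cov: "has_bochner_integral M (\<lambda>\<omega>. e \<omega> $ i * cnj (e \<omega> $ j)) (if i = j then complex_of_real s else 0)"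
    if "i < m" "j < m" for i j
    using e_moments(2)[OF that] by (simp only:)
  have coord: "has_bochner_integral M
      (\<lambda>\<omega>. (cmod ((\<Sum>k<N. P $$ (i, k) * x \<omega> $ k) + (\<Sum>l<m. X $$ (i, l) * e \<omega> $ l)))\<^sup>2)
      ((\<Sum>k<N. (cmod (P $$ (i, k)))\<^sup>2) + s * (\<Sum>l<m. (cmod (X $$ (i, l)))\<^sup>2))" for i
    by (rule mean_square_linear_combination[OF x x_moment e e_moments(1) e_cov indep_x_e])
  have error: "(cvec_norm (X *\<^sub>v (A *\<^sub>v x \<omega> + e \<omega>) - x \<omega>))\<^sup>2
      = (\<Sum>i<N. (cmod ((\<Sum>k<N. P $$ (i, k) * x \<omega> $ k) + (\<Sum>l<m. X $$ (i, l) * e \<omega> $ l)))\<^sup>2)"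
    if "\<omega> \<in> space M" for \<omega>
  proof -
    have x\<omega>: "x \<omega> \<in> carrier_vec N" and e\<omega>: "e \<omega> \<in> carrier_vec m"
      using measurable_space[OF x that] measurable_space[OF e that] by simp_all
    have Px: "P *\<^sub>v x \<omega> = X * A *\<^sub>v x \<omega> - x \<omega>"
      unfolding P_def using minus_mult_distrib_mat_vec[OF XA one_carrier_mat x\<omega>] x\<omega> by simp
    have "X *\<^sub>v (A *\<^sub>v x \<omega> + e \<omega>) = X * A *\<^sub>v x \<omega> + X *\<^sub>v e \<omega>"
      using mult_add_distrib_mat_vec[OF X _ e\<omega>, of "A *\<^sub>v x \<omega>"] assoc_mult_mat_vec[OF X A x\<omega>] A x\<omega> by simp
    also have "\<dots> - x \<omega> = P *\<^sub>v x \<omega> + X *\<^sub>v e \<omega>"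
      unfolding Px using X XA x\<omega> e\<omega> by (intro eq_vecI) (auto simp del: assoc_mult_mat_vec)
    finally have eq: "X *\<^sub>v (A *\<^sub>v x \<omega> + e \<omega>) - x \<omega> = P *\<^sub>v x \<omega> + X *\<^sub>v e \<omega>" .
    have "(P *\<^sub>v x \<omega> + X *\<^sub>v e \<omega>) $ i
        = (\<Sum>k<N. P $$ (i, k) * x \<omega> $ k) + (\<Sum>l<m. X $$ (i, l) * e \<omega> $ l)" if "i < N" for i
      using P X x\<omega> e\<omega> that by (simp add: scalar_prod_def lessThan_atLeast0)
    then show ?thesis
      unfolding eq cvec_norm_sq using X by simp
  qed
  have "(\<integral>\<omega>. (cvec_norm (X *\<^sub>v (A *\<^sub>v x \<omega> + e \<omega>) - x \<omega>))\<^sup>2 \<partial>M)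
      = (\<integral>\<omega>. (\<Sum>i<N. (cmod ((\<Sum>k<N. P $$ (i, k) * x \<omega> $ k) + (\<Sum>l<m. X $$ (i, l) * e \<omega> $ l)))\<^sup>2) \<partial>M)"
    using error by (intro Bochner_Integration.integral_cong) auto
  also have "\<dots> = (\<Sum>i<N. (\<Sum>k<N. (cmod (P $$ (i, k)))\<^sup>2) + s * (\<Sum>l<m. (cmod (X $$ (i, l)))\<^sup>2))"
    by (intro has_bochner_integral_integral_eq has_bochner_integral_sum coord)
  also have "\<dots> = frobenius_sq P + s * frobenius_sq X"
    unfolding frobenius_sq_def carrier_matD[OF P] carrier_matD[OF X] sum.distrib sum_distrib_left ..
  finally show ?thesis by (simp add: P_def s_def)
qed

text \<open>\<open>gram_inverse\<close> is applied to the adjoint of A. All diagonal entries equal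
  m, so \<alpha> = sqrt m and the trace bounds are N equal summands.\<close>

lemma fourier_pinv_overdetermined:
  fixes \<beta> \<eta> :: real
  assumes m: "0 < m" and N: "N = 2 * q + 1" and Nm: "N \<le> m"
    and close: "frobenius_sq (fourier_mat m q t - equispaced_mat m q) \<le> \<beta>\<^sup>2" and \<beta>: "0 \<le> \<beta>"
    and \<eta>: "\<eta> = 2 * sqrt (real m) * \<beta> + \<beta>\<^sup>2" "\<eta> < real m"
  obtains X where "is_moore_penrose_inverse (fourier_mat m q t) X"
    "X * fourier_mat m q t = 1\<^sub>m N"
    "real N / (real m + \<eta>) \<le> frobenius_sq X" "frobenius_sq X \<le> real N / (real m - \<eta>)"
proof -
  define A F where "A = fourier_mat m q t" and "F = equispaced_mat m q"
  have A: "A \<in> carrier_mat m N" and F: "F \<in> carrier_mat m N"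
    using fourier_mat_carrier equispaced_mat_carrier N by (simp_all only: A_def F_def)
  note A' = mat_adjoint_carrier[OF A] and F' = mat_adjoint_carrier[OF F]
  have AF: "A - F \<in> carrier_mat m N" using F by (simp add: minus_carrier_mat)
  \<comment> \<open>Brings the perturbation of the adjoint back to A - F, whose Frobenius norm is
    controlled.\<close>
  have diff: "mat_adjoint (mat_adjoint A - mat_adjoint F) = A - F"
  proof -
    have "mat_adjoint A - mat_adjoint F = mat_adjoint (A - F)"
      using A F A' F' AF mat_adjoint_carrier[OF AF]
      by (intro eq_matI) (auto simp: mat_adjoint_index[of _ m N])
    then show ?thesis by (simp only: mat_adjoint_adjoint[OF AF])
  qed
  have gram: "mat_adjoint F * mat_adjoint (mat_adjoint F) = mat_diag N (\<lambda>_. complex_of_real (real m))"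
    unfolding mat_adjoint_adjoint[OF F] unfolding F_def by (rule equispaced_mat_gram_columns[OF m N Nm])
  obtain H where H: "H \<in> carrier_mat N N"
    and inv: "(mat_adjoint A * A) * H = 1\<^sub>m N" "H * (mat_adjoint A * A) = 1\<^sub>m N" "mat_adjoint H = H"
    and tr: "(\<Sum>r<N. 1 / (real m + \<eta>)) \<le> Re (mat_trace H)" "Re (mat_trace H) \<le> (\<Sum>r<N. 1 / (real m - \<eta>))"
  proof (rule gram_inverse[OF A' F' gram _ _ _ \<beta> \<eta>])
    fix w :: "complex vec" assume "w \<in> carrier_vec N"
    then show "cvec_norm (mat_adjoint (mat_adjoint A - mat_adjoint F) *\<^sub>v w) \<le> \<beta> * cvec_norm w"
      unfolding diff using cvec_norm_mult_mat_vec_le[OF AF _ _ \<beta>] close by (simp add: A_def F_def)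
  qed (use mat_adjoint_adjoint[OF A] in auto)
  note pinv = full_column_rank_moore_penrose_inverse[OF A H inv]
  show thesis
    by (rule that[of "H * mat_adjoint A"]) (use pinv tr in \<open>simp_all add: A_def\<close>)
qed

text \<open>Rotating by the unitary \<open>U\<close> diagonalises the unperturbed Gram matrix, with
  b entries m (a + 1) and m - b entries m a; \<alpha>^2 is the largest of them and m a the
  smallest.\<close>

lemma fourier_pinv_underdetermined:
  fixes \<alpha> \<beta> \<eta> :: real
  assumes m: "0 < m" and N: "N = 2 * q + 1" and ab: "N = a * m + b" "b < m"
    and close: "frobenius_sq (fourier_mat m q t - equispaced_mat m q) \<le> \<beta>\<^sup>2" and \<beta>: "0 \<le> \<beta>"
    and \<alpha>: "\<alpha> = sqrt (real m * (real a + (if b = 0 then 0 else 1)))"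
    and \<eta>: "\<eta> = 2 * \<alpha> * \<beta> + \<beta>\<^sup>2" "\<eta> < real m * real a"
  obtains X where "is_moore_penrose_inverse (fourier_mat m q t) X"
    "fourier_mat m q t * X = 1\<^sub>m m"
    "real b * (1 / (real m * (real a + 1) + \<eta>)) + (real m - real b) * (1 / (real m * real a + \<eta>)) \<le> frobenius_sq X"
    "frobenius_sq X \<le> real b * (1 / (real m * (real a + 1) - \<eta>)) + (real m - real b) * (1 / (real m * real a - \<eta>))"
proof -
  define A F U where "A = fourier_mat m q t" and "F = equispaced_mat m q" and "U = shifted_dft m q"
  define C C0 where "C = mat_adjoint U * A" and "C0 = mat_adjoint U * F"
  define d where "d r = real m * (real a + (if r < b then 1 else 0))" for r
  have A: "A \<in> carrier_mat m N" and F: "F \<in> carrier_mat m N" and U: "U \<in> carrier_mat m m"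
    using fourier_mat_carrier equispaced_mat_carrier shifted_dft_carrier N by (simp_all only: A_def F_def U_def)
  note U' = mat_adjoint_carrier[OF U]
  have AF: "A - F \<in> carrier_mat m N" using F by (simp add: minus_carrier_mat)
  have unitary: "U * mat_adjoint U = 1\<^sub>m m" "mat_adjoint U * U = 1\<^sub>m m"
    unfolding U_def by (rule shifted_dft_unitary[OF m])+
  have C: "C \<in> carrier_mat m N" and C0: "C0 \<in> carrier_mat m N"
    using U' A F by (simp_all add: C_def C0_def)
  have UC: "U * C = A"
    unfolding C_def using assoc_mult_mat[OF U U' A] unitary A by simp
  have gram: "C0 * mat_adjoint C0 = mat_diag m (\<lambda>r. complex_of_real (d r))"
    unfolding C0_def F_def U_def shifted_dft_adjoint_mult_equispaced_mat[OF m] N[symmetric] d_def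
    by (rule residue_mat_gram[OF m ab(2,1)])
  have diff: "mat_adjoint (C - C0) = mat_adjoint (A - F) * U"
  proof -
    have "C - C0 = mat_adjoint U * (A - F)"
      unfolding C_def C0_def by (rule mult_minus_distrib_mat[OF U' A F, symmetric])
    then show ?thesis by (simp only: mat_adjoint_times[OF U' AF] mat_adjoint_adjoint[OF U])
  qed
  \<comment> \<open>\<open>U\<close> preserves norms, so the rotation leaves the perturbation bound
    \<beta> as it is.\<close>
  have isometry: "cvec_norm (U *\<^sub>v w) = cvec_norm w" if w: "w \<in> carrier_vec m" for w
  proof -
    have "(U *\<^sub>v w) \<bullet>c (U *\<^sub>v w) = w \<bullet>c w"
      using cscalar_prod_mult_mat_vec[OF U w, of "U *\<^sub>v w"] U w
        assoc_mult_mat_vec[OF U' U w] unitary by simp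
    then show ?thesis
      unfolding cscalar_prod_self by (simp only: of_real_eq_iff) (simp add: power2_eq_iff_nonneg)
  qed
  have \<alpha>0: "0 \<le> \<alpha>" by (simp add: \<alpha>)
  \<comment> \<open>If b = 0, no index lies below \<open>b\<close>, so \<alpha> can omit the extra
    1.\<close>
  have d_le: "d r \<le> \<alpha>\<^sup>2" for r by (auto simp: d_def \<alpha> intro!: mult_left_mono)
  have \<eta>_d: "\<eta> < d r" for r using \<eta>(2) m by (simp add: d_def algebra_simps)
  obtain H where H: "H \<in> carrier_mat m m"
    and inv: "(C * mat_adjoint C) * H = 1\<^sub>m m" "mat_adjoint H = H"
    and tr: "(\<Sum>r<m. 1 / (d r + \<eta>)) \<le> Re (mat_trace H)" "Re (mat_trace H) \<le> (\<Sum>r<m. 1 / (d r - \<eta>))"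
  proof (rule gram_inverse[OF C C0 gram _ \<alpha>0 d_le \<beta> \<eta>(1) \<eta>_d])
    fix w :: "complex vec" assume w: "w \<in> carrier_vec m"
    have "frobenius_sq (mat_adjoint (A - F)) \<le> \<beta>\<^sup>2"
      unfolding frobenius_sq_adjoint[OF AF] using close by (simp add: A_def F_def)
    then have "cvec_norm (mat_adjoint (A - F) *\<^sub>v (U *\<^sub>v w)) \<le> \<beta> * cvec_norm (U *\<^sub>v w)"
      using U w \<beta> by (intro cvec_norm_mult_mat_vec_le[OF mat_adjoint_carrier[OF AF]]) auto
    then show "cvec_norm (mat_adjoint (C - C0) *\<^sub>v w) \<le> \<beta> * cvec_norm w"
      unfolding diff isometry[OF w] assoc_mult_mat_vec[OF mat_adjoint_carrier[OF AF] U w] .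
  qed auto
  note pinv = full_row_rank_moore_penrose_inverse[OF C H U inv unitary, unfolded UC]
  \<comment> \<open>\<open>s\<close> becomes \<eta> for the lower and - \<eta> for the upper
    bound.\<close>
  have sums: "(\<Sum>r<m. 1 / (d r + s))
      = real b * (1 / (real m * (real a + 1) + s)) + (real m - real b) * (1 / (real m * real a + s))" for s
  proof -
    have "(\<Sum>r<m. 1 / (d r + s)) = (\<Sum>r<m. 1 / (real m * (if r < b then real a + 1 else real a) + s))"
      by (intro sum.cong) (auto simp: d_def)
    then show ?thesis
      using sum_split_eigenvalues[of b m "\<lambda>u. 1 / (real m * u + s)" "real a + 1" "real a"] ab(2) by simp
  qed
  show thesis
  proof (rule that)
    show "is_moore_penrose_inverse (fourier_mat m q t) (mat_adjoint C * H * mat_adjoint U)"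
      and "fourier_mat m q t * (mat_adjoint C * H * mat_adjoint U) = 1\<^sub>m m"
      using pinv by (simp_all only: A_def)
  qed (use tr sums[of \<eta>] sums[of "- \<eta>"] pinv(3) in simp_all)
qed

theorem theorem14:
  fixes q m N a b :: nat
    and T \<epsilon> \<beta> :: real
    and \<delta> t :: "nat \<Rightarrow> real"
    and A :: "complex mat"
    and M :: "'w measure"
    and x e y xhat :: "'w \<Rightarrow> complex vec"
  assumes m: "m \<ge> 1"
    and N: "N = 2 * q + 1"
    and T: "0 < T" "T < 1 / real m"
    and \<delta>: "\<And>l. l \<in> {1..m} \<Longrightarrow> \<delta> l \<in> {0<..<T}"
    and t: "\<And>l. l \<in> {1..m} \<Longrightarrow> t l = (real l - 1) / real m + \<delta> l"
    and A: "A = fourier_mat m q t"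
    and a: "a = N div m"
    and b: "b = N mod m"
    and \<beta>: "\<beta> = pi * sqrt (real m) * real N powr (3 / 2) * T"
    and \<epsilon>: "\<epsilon> > 0"
    and M: "prob_space M"
    and x: "x \<in> measurable M (vec_borel N)"
    and x_moment: "mat N N (\<lambda>(i, j). \<integral>\<omega>. x \<omega> $ i * cnj (x \<omega> $ j) \<partial>M) = 1\<^sub>m N"
    and e: "e \<in> measurable M (vec_borel m)"
    and Re_e: "distr M (vec_borel m) (\<lambda>\<omega>. map_vec Re (e \<omega>)) =
                 gaussian_vec m (sqrt (\<epsilon>\<^sup>2 / (2 * real m)))"
    and Im_e: "distr M (vec_borel m) (\<lambda>\<omega>. map_vec Im (e \<omega>)) =
                 gaussian_vec m (sqrt (\<epsilon>\<^sup>2 / (2 * real m)))"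
    and indep_Re_Im: "prob_space.indep_var M
                 (vec_borel m) (\<lambda>\<omega>. map_vec Re (e \<omega>)) (vec_borel m) (\<lambda>\<omega>. map_vec Im (e \<omega>))"
    and indep_x_e: "prob_space.indep_var M (vec_borel N) x (vec_borel m) e"
    and y: "y = (\<lambda>\<omega>. A *\<^sub>v x \<omega> + e \<omega>)"
    and xhat: "xhat = (\<lambda>\<omega>. moore_penrose_inverse A *\<^sub>v y \<omega>)"
  shows
    "(m \<ge> N \<and> T < min (1 / real m) (1 / ((sqrt 2 + 1) * pi * real N powr (3 / 2))) \<longrightarrow>
       (let \<alpha> = sqrt (real m);
            \<eta> = 2 * \<alpha> * \<beta> + \<beta>\<^sup>2
        in real N / (real m * (real m + \<eta>)) * \<epsilon>\<^sup>2
             \<le> (\<integral>\<omega>. (cvec_norm (xhat \<omega> - x \<omega>))\<^sup>2 \<partial>M) \<and>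
           (\<integral>\<omega>. (cvec_norm (xhat \<omega> - x \<omega>))\<^sup>2 \<partial>M)
             \<le> real N / (real m * (real m - \<eta>)) * \<epsilon>\<^sup>2))
     \<and>
     (m < N \<and> T < min (1 / real m)
          ((sqrt (2 * real N) - sqrt (real N + real m)) / (pi * sqrt (real m) * real N powr (3 / 2))) \<longrightarrow>
       (let \<alpha> = sqrt (real m * real_of_int \<lceil>real N / real m\<rceil>);
            \<eta> = 2 * \<alpha> * \<beta> + \<beta>\<^sup>2
        in (real N + real m + \<eta> - 2 * real b) /
               ((real m * real a + \<eta>) * (real m * (real a + 1) + \<eta>)) * \<epsilon>\<^sup>2 + (real N - real m)
             \<le> (\<integral>\<omega>. (cvec_norm (xhat \<omega> - x \<omega>))\<^sup>2 \<partial>M) \<and>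
           (\<integral>\<omega>. (cvec_norm (xhat \<omega> - x \<omega>))\<^sup>2 \<partial>M)
             \<le> (real N + real m - \<eta> - 2 * real b) /
               ((real m * real a - \<eta>) * (real m * (real a + 1) - \<eta>)) * \<epsilon>\<^sup>2 + (real N - real m)))"
proof (intro conjI impI)
  interpret prob_space M by (rule M)
  let ?E = "\<integral>\<omega>. (cvec_norm (xhat \<omega> - x \<omega>))\<^sup>2 \<partial>M"
  have m0: "0 < m" and N0: "0 < N" using m N by simp_all
  have A_carrier: "A \<in> carrier_mat m N" unfolding A N by (rule fourier_mat_carrier)
  have \<beta>0: "0 \<le> \<beta>" using T by (simp add: \<beta>)
  have "\<bar>t l - (real l - 1) / real m\<bar> \<le> T" if "l \<in> {1..m}" for l
    using t[OF that] \<delta>[OF that] by simp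
  then have close: "frobenius_sq (fourier_mat m q t - equispaced_mat m q) \<le> \<beta>\<^sup>2"
    unfolding \<beta> using N by (rule frobenius_sq_fourier_mat_minus_equispaced)
  \<comment> \<open>Uniqueness identifies any \<open>X\<close> with the Penrose properties as the
    pseudoinverse in \<open>xhat\<close>, so the formula applies to the matrix built in either
    case.\<close>
  have error: "?E = frobenius_sq (X * A - 1\<^sub>m N) + \<epsilon>\<^sup>2 / real m * frobenius_sq X"
    if X: "is_moore_penrose_inverse A X" for X
  proof -
    have "X \<in> carrier_mat N m" using X A_carrier by (simp add: is_moore_penrose_inverse_def)
    from mean_square_reconstruction_error[OF A_carrier this m0 \<epsilon> x x_moment e Re_e Im_e indep_Re_Im indep_x_e]
    show ?thesis unfolding xhat y moore_penrose_inverse_eqI[OF X] .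
  qed
  have \<epsilon>m: "0 \<le> \<epsilon>\<^sup>2 / real m" by simp
  {
    assume "m \<ge> N \<and> T < min (1 / real m) (1 / ((sqrt 2 + 1) * pi * real N powr (3 / 2)))"
    then have Nm: "N \<le> m" and bound: "T < 1 / ((sqrt 2 + 1) * pi * real N powr (3 / 2))" by auto
    define \<eta> where "\<eta> = 2 * sqrt (real m) * \<beta> + \<beta>\<^sup>2"
    have \<eta>m: "\<eta> < real m"
      unfolding \<eta>_def using overdetermined_eta_less[OF _ _ T(1) bound \<beta>] m0 N0 by simp
    obtain X where X: "is_moore_penrose_inverse A X" "X * A = 1\<^sub>m N"
      and bounds: "real N / (real m + \<eta>) \<le> frobenius_sq X" "frobenius_sq X \<le> real N / (real m - \<eta>)"
      using fourier_pinv_overdetermined[OF m0 N Nm close \<beta>0 \<eta>_def \<eta>m] unfolding A by blast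
    \<comment> \<open>A left inverse recovers \<open>x\<close> exactly; only the noise
      contributes.\<close>
    have "frobenius_sq (X * A - 1\<^sub>m N) = 0" by (simp add: X(2) frobenius_sq_def)
    then have E: "?E = \<epsilon>\<^sup>2 / real m * frobenius_sq X" using error[OF X(1)] by simp
    show "let \<alpha> = sqrt (real m); \<eta> = 2 * \<alpha> * \<beta> + \<beta>\<^sup>2
      in real N / (real m * (real m + \<eta>)) * \<epsilon>\<^sup>2 \<le> ?E \<and> ?E \<le> real N / (real m * (real m - \<eta>)) * \<epsilon>\<^sup>2"
      using mult_left_mono[OF bounds(1) \<epsilon>m] mult_left_mono[OF bounds(2) \<epsilon>m]
      unfolding Let_def \<eta>_def[symmetric] E by (simp add: mult_ac)
  next
    assume "m < N \<and> T < min (1 / real m)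
      ((sqrt (2 * real N) - sqrt (real N + real m)) / (pi * sqrt (real m) * real N powr (3 / 2)))"
    then have mN: "m < N"
      and bound: "T < (sqrt (2 * real N) - sqrt (real N + real m)) / (pi * sqrt (real m) * real N powr (3 / 2))"
      by auto
    have Nab: "N = a * m + b" and bm: "b < m" using m0 by (simp_all add: a b)
    \<comment> \<open>Every residue class contains a frequency, so the smallest diagonal entry m a
      is positive.\<close>
    have a1: "1 \<le> a" using mN m0 by (simp add: a div_greater_zero_iff Suc_le_eq)
    have "0 < pi * sqrt (real m) * real N powr (3 / 2)" using m0 N0 by simp
    then have \<beta>_less: "\<beta> < sqrt (2 * real N) - sqrt (real N + real m)"
      using bound by (simp add: \<beta> pos_less_divide_eq mult_ac)
    define \<alpha> where "\<alpha> = sqrt (real m * (real a + (if b = 0 then 0 else 1)))"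
    define \<eta> where "\<eta> = 2 * \<alpha> * \<beta> + \<beta>\<^sup>2"
    have ceil: "sqrt (real m * real_of_int \<lceil>real N / real m\<rceil>) = \<alpha>"
      unfolding Nab ceiling_divide_nat[OF m0 bm] \<alpha>_def by simp
    have \<eta>_less: "\<eta> < real m * real a"
      unfolding \<eta>_def by (rule underdetermined_eta_less[OF m0 bm a1 Nab \<beta>0 \<beta>_less \<alpha>_def])
    obtain X where X: "is_moore_penrose_inverse A X" "A * X = 1\<^sub>m m"
      and bounds: "real b * (1 / (real m * (real a + 1) + \<eta>)) + (real m - real b) * (1 / (real m * real a + \<eta>))
          \<le> frobenius_sq X"
        "frobenius_sq X
          \<le> real b * (1 / (real m * (real a + 1) - \<eta>)) + (real m - real b) * (1 / (real m * real a - \<eta>))"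
      using fourier_pinv_underdetermined[OF m0 N Nab bm close \<beta>0 \<alpha>_def \<eta>_def \<eta>_less] unfolding A by blast
    have "0 \<le> \<eta>" using \<beta>0 by (simp add: \<eta>_def \<alpha>_def)
    \<comment> \<open>The denominators with - \<eta> are kept as sums to fit
      \<open>two_eigenvalue_trace\<close> at - \<eta>.\<close>
    then have nz: "real m * real a + \<eta> \<noteq> 0" "real m * (real a + 1) + \<eta> \<noteq> 0"
      "real m * real a + - \<eta> \<noteq> 0" "real m * (real a + 1) + - \<eta> \<noteq> 0"
      using \<eta>_less m0 by (auto simp: distrib_left)
    have N': "real N = real m * real a + real b" by (simp add: Nab)
    have m0': "0 < real m" using m0 by simp
    have X_carrier: "X \<in> carrier_mat N m" and herm: "mat_adjoint (X * A) = X * A"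
      using X(1) A_carrier by (simp_all add: is_moore_penrose_inverse_def)
    \<comment> \<open>The component of \<open>x\<close> in the kernel of A is lost; this accounts
      for N - m.\<close>
    have E: "?E = frobenius_sq X / real m * \<epsilon>\<^sup>2 + (real N - real m)"
      unfolding error[OF X(1)] frobenius_sq_minus_projection[OF A_carrier X_carrier X(2) herm] by simp
    have scaled: "u / real m * \<epsilon>\<^sup>2 \<le> v / real m * \<epsilon>\<^sup>2" if "u \<le> v" for u v
      using that m0 by (intro mult_right_mono divide_right_mono) auto
    show "let \<alpha> = sqrt (real m * real_of_int \<lceil>real N / real m\<rceil>); \<eta> = 2 * \<alpha> * \<beta> + \<beta>\<^sup>2
      in (real N + real m + \<eta> - 2 * real b) /
               ((real m * real a + \<eta>) * (real m * (real a + 1) + \<eta>)) * \<epsilon>\<^sup>2 + (real N - real m) \<le> ?E \<and>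
         ?E \<le> (real N + real m - \<eta> - 2 * real b) /
               ((real m * real a - \<eta>) * (real m * (real a + 1) - \<eta>)) * \<epsilon>\<^sup>2 + (real N - real m)"
      using scaled[OF bounds(1), unfolded two_eigenvalue_trace[OF m0' N' nz(1,2)]]
        scaled[OF bounds(2), unfolded two_eigenvalue_trace[OF m0' N' nz(3,4), unfolded add_uminus_conv_diff]]
      unfolding Let_def ceil \<eta>_def[symmetric] E by simp
  }
qed

end
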